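(* Let $k=(k_1,k_2)\in\mathbb{C}^2$ and let $\mathcal{G}_\pm(k)=\Upsilon^{-1}\circ\widehat{G}^U_\pm(k)\circ\Upsilon$ and $\mathcal{E}_\pm(k)=\Upsilon^{-1}\circ\widehat{E}^U_\pm(k)\circ\Upsilon$ be the $\Upsilon$-pullbacks of $\widehat{G}^U_\pm(k)$ and $\widehat{E}^U_\pm(k)$. Explicitly, $$\mathcal{G}_+(k)=G_+(k)-\frac{z(1-s)}{(z-z^{-1})^2},\qquad \mathcal{G}_-(k)=G_-(k)+z^{-1}-zs,$$ $$\mathcal{E}_+(k)=E_+(k)-\frac{1+z^{-1}}{1-z^{-1}}\,\frac{1-s}{z-z^{-1}},\qquad \mathcal{E}_-(k)=E_-(k)+\frac{1-z^{-1}}{1+z^{-1}}\,\frac{1-s}{z-z^{-1}}.$$ Moreover $\mathcal{G}_\pm(k)$ and $\mathcal{E}_\pm(k)$ are non-symmetric shift operators with shifts $(0,\pm1)$ and $(\pm2,\mp1)$, respectively.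
   Context: Let $s$ act on $\mathbb{C}[z^{\pm1}]$ by $s(f)(z)=f(z^{-1})$, $\mathbb{Z}_2=\langle s\rangle$, $\rho(k)=\frac12(k_1+2k_2)$. The Cherednik operator is $$D_k=z\partial_z+k_1\frac{1}{1-z^{-1}}(1-s)+2k_2\frac{1}{1-z^{-2}}(1-s)-\rho(k).$$ Let $\mathbb{C}_\Delta[z^\pm]$ be the localization of $\mathbb{C}[z^{\pm1}]$ at $\Delta=z-z^{-1}$. An element $\mathcal{S}(k)\in\mathbb{C}_\Delta[z^\pm]\otimes\mathbb{C}[z\partial_z]\otimes\mathbb{C}[\mathbb{Z}_2]$ (a differential-reflection operator) is a non-symmetric shift operator with shift $\ell\in2\mathbb{Z}\times\mathbb{Z}$ if (i) $\mathcal{S}(k)D_k=D_{k+\ell}\mathcal{S}(k)$, and (ii) $\mathcal{S}(k)$ maps $\mathbb{C}[z^{\pm1}]$ to itself. Scalar operators: $$G_+(k)=\frac{1}{z-z^{-1}}z\partial_z,\quad G_-(k)=(z-z^{-1})z\partial_z+(k_1+2k_2-1)(z+z^{-1})+2k_1,$$ $$E_+(k)=\frac{1+z^{-1}}{1-z^{-1}}z\partial_z+k_2-\tfrac12,\quad E_-(k)=\frac{1-z^{-1}}{1+z^{-1}}z\partial_z+k_1+k_2-\tfrac12.$$ Put $k_+=k+(1,0)$, $k_-=k+(-1,1)$, $U=\frac1{\sqrt2}\begin{pmatrix}1&-1\\1&1\end{pmatrix}$, $\widehat{G}_\pm(k)=\mathrm{diag}(G_\pm(k_+),G_\pm(k_-))$,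 $$\widehat{E}_+(k)=\begin{pmatrix}E_+(k_+)&0\\-1&E_+(k_-)\end{pmatrix},\quad\widehat{E}_-(k)=\begin{pmatrix}E_-(k_+)&-1\\0&E_-(k_-)\end{pmatrix},$$ $\widehat{G}^U_\pm(k)=U^{-1}\widehat{G}_\pm(k)U$, $\widehat{E}^U_\pm(k)=U^{-1}\widehat{E}_\pm(k)U$. With $x=(z+z^{-1})/2$, every $f\in\mathbb{C}[z^{\pm1}]$ is uniquely $f=f_1+f_2z$ with $f_1,f_2\in\mathbb{C}[x]$, and $\Upsilon:\mathbb{C}[z^{\pm1}]\to\mathbb{C}[x]\otimes\mathbb{C}^2$ is the isomorphism $f\mapsto(f_1,f_2)^T$. *)

theory Defs
  imports
    "HOL-Analysis.Analysis"
    "HOL-Library.Poly_Mapping"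
    "HOL-Computational_Algebra.Polynomial_Factorial"
begin

section \<open>Laurent polynomials and rational functions in \<open>z\<close>\<close>

text \<open>
  \<open>\<complex>[z\<^sup>\<plusminus>\<^sup>1]\<close> is the group algebra of the integers (the coefficient of \<open>z\<^sup>n\<close> is the value at
  \<open>n\<close>), and \<open>ratfun\<close> is its field of fractions \<open>\<complex>(z)\<close>. The spaces \<open>\<complex>[z\<^sup>\<plusminus>\<^sup>1]\<close>, its localization at
  \<open>\<Delta>\<close>, and \<open>\<complex>[x]\<close> are taken as subsets of \<open>ratfun\<close>.
\<close>

type_synonym laurent = "int \<Rightarrow>\<^sub>0 complex"
type_synonym ratfun = "laurent fract"

definition refl_laurent :: "laurent \<Rightarrow> laurent" where
  "refl_laurent f = Poly_Mapping.map_key uminus f"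

definition theta_laurent :: "laurent \<Rightarrow> laurent" where
  "theta_laurent f = Poly_Mapping.mapp (\<lambda>n c. of_int n * c) f"

lemma lookup_refl_laurent:
  "Poly_Mapping.lookup (refl_laurent f) n = Poly_Mapping.lookup f (- n)"
  unfolding refl_laurent_def by (simp add: map_key.rep_eq)

lemma lookup_theta_laurent:
  "Poly_Mapping.lookup (theta_laurent f) n = of_int n * Poly_Mapping.lookup f n"
  unfolding theta_laurent_def by (simp add: lookup_mapp in_keys_iff when_def)

lemma refl_laurent_single:
  "refl_laurent (Poly_Mapping.single n c) = Poly_Mapping.single (- n) c"
  by (rule poly_mapping_eqI) (auto simp: lookup_refl_laurent lookup_single when_def)

lemma theta_laurent_single:
  "theta_laurent (Poly_Mapping.single n c) = Poly_Mapping.single n (of_int n * c)"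
  by (rule poly_mapping_eqI) (auto simp: lookup_theta_laurent lookup_single when_def)

lemma refl_laurent_add: "refl_laurent (f + g) = refl_laurent f + refl_laurent g"
  by (rule poly_mapping_eqI) (simp add: lookup_refl_laurent lookup_add)

lemma theta_laurent_add: "theta_laurent (f + g) = theta_laurent f + theta_laurent g"
  by (rule poly_mapping_eqI) (simp add: lookup_theta_laurent lookup_add algebra_simps)

lemma refl_laurent_refl_laurent: "refl_laurent (refl_laurent f) = f"
  by (rule poly_mapping_eqI) (simp add: lookup_refl_laurent)

lemma refl_laurent_0: "refl_laurent 0 = 0"
  by (rule poly_mapping_eqI) (simp add: lookup_refl_laurent)

lemma theta_laurent_0: "theta_laurent 0 = 0"
  by (rule poly_mapping_eqI) (simp add: lookup_theta_laurent)

lemma refl_laurent_eq_0_iff: "refl_laurent f = 0 \<longleftrightarrow> f = 0"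
  by (metis refl_laurent_0 refl_laurent_refl_laurent)

lemma laurent_induct:
  fixes f :: laurent
  assumes "P 0"
    and "\<And>f g. P f \<Longrightarrow> P g \<Longrightarrow> P (f + g)"
    and "\<And>n c. P (Poly_Mapping.single n c)"
  shows "P f"
proof (induction f rule: update_induct)
  case const
  show ?case by (fact assms(1))
next
  case (update f a b)
  have "Poly_Mapping.update a b f = f + Poly_Mapping.single a b"
    using update.hyps
    by (intro poly_mapping_eqI)
      (auto simp: lookup_update lookup_add lookup_single when_def in_keys_iff)
  with update.IH assms show ?case by simp
qed

lemma refl_laurent_mult: "refl_laurent (f * g) = refl_laurent f * refl_laurent g"
proof (induction f rule: laurent_induct)
  case (3 n c)
  show ?case
    by (induction g rule: laurent_induct)
      (simp_all add: refl_laurent_0 refl_laurent_add refl_laurent_single mult_single ring_distribs)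
qed (simp_all add: refl_laurent_0 refl_laurent_add ring_distribs)

lemma theta_laurent_mult:
  "theta_laurent (f * g) = theta_laurent f * g + f * theta_laurent g"
proof (induction f rule: laurent_induct)
  case (3 n c)
  show ?case
    by (induction g rule: laurent_induct)
      (simp_all add: theta_laurent_0 theta_laurent_add theta_laurent_single mult_single
        ring_distribs single_add add.commute mult_ac)
qed (simp_all add: theta_laurent_0 theta_laurent_add ring_distribs)

text \<open>
  The extensions of \<open>s\<close> (as a field automorphism) and of \<open>z\<partial>\<^sub>z\<close> (as a derivation) to \<open>\<complex>(z)\<close>. The lemmas
  \<open>s_act_Fract\<close> and \<open>theta_Fract\<close> show that the values do not depend on the chosen fraction.
\<close>

definition s_act :: "ratfun \<Rightarrow> ratfun" where
  "s_act q = (THE r. \<exists>a b. b \<noteq> 0 \<and> q = Fract a b \<and> r = Fract (refl_laurent a) (refl_laurent b))"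

definition theta :: "ratfun \<Rightarrow> ratfun" where
  "theta q = (THE r. \<exists>a b. b \<noteq> 0 \<and> q = Fract a b \<and>
     r = Fract (theta_laurent a * b - a * theta_laurent b) (b * b))"

lemma s_act_Fract:
  assumes "b \<noteq> 0"
  shows "s_act (Fract a b) = Fract (refl_laurent a) (refl_laurent b)"
  unfolding s_act_def
proof (rule the_equality)
  fix r assume "\<exists>c d. d \<noteq> 0 \<and> Fract a b = Fract c d \<and> r = Fract (refl_laurent c) (refl_laurent d)"
  then obtain c d where *: "d \<noteq> 0" "Fract a b = Fract c d"
      "r = Fract (refl_laurent c) (refl_laurent d)" by blast
  with assms have "a * d = c * b" by (simp add: eq_fract)
  then have "refl_laurent a * refl_laurent d = refl_laurent c * refl_laurent b"
    by (metis refl_laurent_mult)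
  with assms * show "r = Fract (refl_laurent a) (refl_laurent b)"
    by (simp add: eq_fract refl_laurent_eq_0_iff)
qed (use assms in blast)

lemma theta_Fract:
  assumes "b \<noteq> 0"
  shows "theta (Fract a b) = Fract (theta_laurent a * b - a * theta_laurent b) (b * b)"
  unfolding theta_def
proof (rule the_equality)
  fix r assume "\<exists>c d. d \<noteq> 0 \<and> Fract a b = Fract c d \<and>
     r = Fract (theta_laurent c * d - c * theta_laurent d) (d * d)"
  then obtain c d where *: "d \<noteq> 0" "Fract a b = Fract c d"
      "r = Fract (theta_laurent c * d - c * theta_laurent d) (d * d)" by blast
  with assms have eq: "a * d = c * b" by (simp add: eq_fract)
  have eq': "theta_laurent a * d + a * theta_laurent d = theta_laurent c * b + c * theta_laurent b"
    using arg_cong [OF eq, of theta_laurent] by (simp add: theta_laurent_mult)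
  have "(theta_laurent a * b - a * theta_laurent b) * (d * d)
      - (theta_laurent c * d - c * theta_laurent d) * (b * b)
      = b * d * ((theta_laurent a * d + a * theta_laurent d)
               - (theta_laurent c * b + c * theta_laurent b))
        - (b * theta_laurent d + d * theta_laurent b) * (a * d - c * b)"
    by (simp add: algebra_simps)
  also have "\<dots> = 0" by (simp add: eq eq')
  finally show "r = Fract (theta_laurent a * b - a * theta_laurent b) (b * b)"
    using assms * by (simp add: eq_fract)
qed (use assms in blast)

definition cst :: "complex \<Rightarrow> ratfun" where
  "cst c = to_fract (Poly_Mapping.single 0 c)"

definition Z :: ratfun where
  "Z = to_fract (Poly_Mapping.single 1 1)"

definition X :: ratfun where
  "X = (Z + inverse Z) / 2"

definition Delta :: ratfun where
  "Delta = Z - inverse Z"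

definition Laurent :: "ratfun set" where
  "Laurent = range to_fract"

definition Laurent_Delta :: "ratfun set" where
  "Laurent_Delta = {f / Delta ^ m | f m. f \<in> Laurent}"

definition Poly_x :: "ratfun set" where
  "Poly_x = {poly (map_poly cst p) X | p :: complex poly. True}"

section \<open>Differential-reflection operators and shift operators\<close>

text \<open>
  The algebra \<open>\<complex>\<^sub>\<Delta>[z\<^sup>\<plusminus>] \<otimes> \<complex>[z\<partial>\<^sub>z] \<otimes> \<complex>[\<int>\<^sub>2]\<close> acts faithfully on \<open>\<complex>(z)\<close> (already on \<open>\<complex>[z\<^sup>\<plusminus>\<^sup>1]\<close>),
  and it is identified with its image in the endomorphisms of \<open>\<complex>(z)\<close>. Thus the product of the
  algebra is composition, and equality of elements is equality of functions on \<open>\<complex>(z)\<close>.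
\<close>

definition diff_refl_ops :: "(ratfun \<Rightarrow> ratfun) set" where
  "diff_refl_ops =
    {(\<lambda>f. \<Sum>j<n. a j * (theta ^^ j) f + b j * (theta ^^ j) (s_act f)) | n a b.
      (\<forall>j<n. a j \<in> Laurent_Delta \<and> b j \<in> Laurent_Delta)}"

definition rho :: "complex \<times> complex \<Rightarrow> complex" where
  "rho k = (fst k + 2 * snd k) / 2"

definition Cherednik :: "complex \<times> complex \<Rightarrow> ratfun \<Rightarrow> ratfun" where
  "Cherednik k f =
    theta f + cst (fst k) * (1 / (1 - inverse Z)) * (f - s_act f)
    + 2 * cst (snd k) * (1 / (1 - inverse Z ^ 2)) * (f - s_act f) - cst (rho k) * f"

definition shift_by :: "complex \<times> complex \<Rightarrow> int \<times> int \<Rightarrow> complex \<times> complex" where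
  "shift_by k l = (fst k + of_int (fst l), snd k + of_int (snd l))"

definition nonsym_shift_operator ::
    "complex \<times> complex \<Rightarrow> int \<times> int \<Rightarrow> (ratfun \<Rightarrow> ratfun) \<Rightarrow> bool" where
  "nonsym_shift_operator k l S \<longleftrightarrow>
    even (fst l) \<and> S \<in> diff_refl_ops \<and>
    S \<circ> Cherednik k = Cherednik (shift_by k l) \<circ> S \<and>
    (\<forall>f\<in>Laurent. S f \<in> Laurent)"

section \<open>The scalar operators and their matrix versions\<close>

definition G_plus :: "complex \<times> complex \<Rightarrow> ratfun \<Rightarrow> ratfun" where
  "G_plus k f = 1 / (Z - inverse Z) * theta f"

definition G_minus :: "complex \<times> complex \<Rightarrow> ratfun \<Rightarrow> ratfun" where
  "G_minus k f =
    (Z - inverse Z) * theta f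
    + (cst (fst k + 2 * snd k - 1) * (Z + inverse Z) + cst (2 * fst k)) * f"

definition E_plus :: "complex \<times> complex \<Rightarrow> ratfun \<Rightarrow> ratfun" where
  "E_plus k f = (1 + inverse Z) / (1 - inverse Z) * theta f + cst (snd k - 1 / 2) * f"

definition E_minus :: "complex \<times> complex \<Rightarrow> ratfun \<Rightarrow> ratfun" where
  "E_minus k f =
    (1 - inverse Z) / (1 + inverse Z) * theta f + cst (fst k + snd k - 1 / 2) * f"

definition mat2 :: "'a \<Rightarrow> 'a \<Rightarrow> 'a \<Rightarrow> 'a \<Rightarrow> 'a ^ 2 ^ 2" where
  "mat2 a b c d = (\<chi> i j. if i = 1 then (if j = 1 then a else b) else (if j = 1 then c else d))"

definition U_mat :: "complex ^ 2 ^ 2" where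
  "U_mat = (let r = 1 / complex_of_real (sqrt 2) in mat2 r (- r) r r)"

definition scalar_mat_act :: "complex ^ 2 ^ 2 \<Rightarrow> ratfun ^ 2 \<Rightarrow> ratfun ^ 2" where
  "scalar_mat_act A v = (\<chi> i. \<Sum>j\<in>UNIV. cst (A $ i $ j) * v $ j)"

definition op_mat_act :: "(ratfun \<Rightarrow> ratfun) ^ 2 ^ 2 \<Rightarrow> ratfun ^ 2 \<Rightarrow> ratfun ^ 2" where
  "op_mat_act A v = (\<chi> i. \<Sum>j\<in>UNIV. (A $ i $ j) (v $ j))"

definition k_plus :: "complex \<times> complex \<Rightarrow> complex \<times> complex" where
  "k_plus k = (fst k + 1, snd k)"

definition k_minus :: "complex \<times> complex \<Rightarrow> complex \<times> complex" where
  "k_minus k = (fst k - 1, snd k + 1)"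

definition G_hat_plus :: "complex \<times> complex \<Rightarrow> (ratfun \<Rightarrow> ratfun) ^ 2 ^ 2" where
  "G_hat_plus k = mat2 (G_plus (k_plus k)) (\<lambda>f. 0) (\<lambda>f. 0) (G_plus (k_minus k))"

definition G_hat_minus :: "complex \<times> complex \<Rightarrow> (ratfun \<Rightarrow> ratfun) ^ 2 ^ 2" where
  "G_hat_minus k = mat2 (G_minus (k_plus k)) (\<lambda>f. 0) (\<lambda>f. 0) (G_minus (k_minus k))"

definition E_hat_plus :: "complex \<times> complex \<Rightarrow> (ratfun \<Rightarrow> ratfun) ^ 2 ^ 2" where
  "E_hat_plus k = mat2 (E_plus (k_plus k)) (\<lambda>f. 0) (\<lambda>f. - f) (E_plus (k_minus k))"

definition E_hat_minus :: "complex \<times> complex \<Rightarrow> (ratfun \<Rightarrow> ratfun) ^ 2 ^ 2" where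
  "E_hat_minus k = mat2 (E_minus (k_plus k)) (\<lambda>f. - f) (\<lambda>f. 0) (E_minus (k_minus k))"

definition conj_U :: "(ratfun \<Rightarrow> ratfun) ^ 2 ^ 2 \<Rightarrow> ratfun ^ 2 \<Rightarrow> ratfun ^ 2" where
  "conj_U A = scalar_mat_act (matrix_inv U_mat) \<circ> op_mat_act A \<circ> scalar_mat_act U_mat"

definition Upsilon :: "ratfun \<Rightarrow> ratfun ^ 2" where
  "Upsilon f = (THE v. v $ 1 \<in> Poly_x \<and> v $ 2 \<in> Poly_x \<and> f = v $ 1 + v $ 2 * Z)"

text \<open>
  \<open>Upsilon\<close> is meaningful on \<open>\<complex>[z\<^sup>\<plusminus>\<^sup>1]\<close> only, so \<open>\<Upsilon>\<^sup>-\<^sup>1 \<circ> A \<circ> \<Upsilon>\<close> is an operator on \<open>\<complex>[z\<^sup>\<plusminus>\<^sup>1]\<close>.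
  A differential-reflection operator \<open>S\<close> is the pullback of \<open>A\<close> if it acts on \<open>\<complex>[z\<^sup>\<plusminus>\<^sup>1]\<close> as this
  composition.
\<close>

definition is_pullback :: "(ratfun ^ 2 \<Rightarrow> ratfun ^ 2) \<Rightarrow> (ratfun \<Rightarrow> ratfun) \<Rightarrow> bool" where
  "is_pullback A S \<longleftrightarrow>
    S \<in> diff_refl_ops \<and> (\<forall>f\<in>Laurent. S f = (inv_into Laurent Upsilon \<circ> A \<circ> Upsilon) f)"

end

theory Submission
  imports Defs
begin

text \<open>
  A differential-reflection operator is determined by its values on the monomials \<open>z\<^sup>n\<close>
  (\<open>diff_refl_ops_eqI\<close>): these have the form \<open>p(n) z\<^sup>n + q(-n) z\<^sup>-\<^sup>n\<close> with \<open>p, q\<close> polynomials over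
  \<open>\<complex>(z)\<close>, and polynomial multiples of \<open>1\<close> and of \<open>z\<^sup>-\<^sup>2\<^sup>n\<close> are linearly independent as
  functions of \<open>n\<close>. Hence a pullback is unique if it exists, and to identify it one may evaluate both
  sides on \<open>f = f\<^sub>1 + f\<^sub>2 z\<close> with \<open>f\<^sub>1, f\<^sub>2 \<in> \<complex>[x]\<close> (\<open>Laurent_decomposition\<close>,
  \<open>Poly_x_components_unique\<close>). There \<open>f - s f = \<Delta> f\<^sub>2\<close>, and \<open>z\<partial>\<^sub>z\<close> acts on \<open>\<complex>[x]\<close> as
  \<open>(\<Delta>/2) d/dx\<close> (\<open>theta_Poly_x\<close>), so the scalar operators restrict to differential operators in \<open>x\<close>
  with polynomial coefficients (\<open>scalar_operators_symmetric\<close>). Conjugation by \<open>U\<close> forms half sums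
  and half differences of the matrix entries (\<open>conj_U_mat2\<close>), which gives the explicit formulas. The
  resulting components lie in \<open>\<complex>[x]\<close>, so that the operators preserve Laurent polynomials.

  Each of the four operators is of the form \<open>p \<theta> + q + r s\<close> with \<open>\<theta> = z\<partial>\<^sub>z\<close>. As \<open>s \<theta> = - \<theta> s\<close>, the
  relation \<open>S D\<^sub>k = D\<^sub>k\<^sub>+\<^sub>l S\<close> amounts to four identities between rational functions
  (\<open>intertwines_Cherednik\<close>), which are then verified for each operator by clearing denominators.
\<close>

section \<open>The field of rational functions with its reflection and derivation\<close>

instance fract :: ("{idom, ring_char_0}") field_char_0
proof
  show "inj (of_nat :: nat \<Rightarrow> 'a fract)"
    by (auto simp: inj_def of_nat_fract eq_fract)
qed

lemma refl_laurent_1: "refl_laurent 1 = 1"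
  using refl_laurent_single[of 0 1] by simp

lemma theta_laurent_1: "theta_laurent 1 = 0"
  using theta_laurent_single[of 0 1] by simp

lemma refl_laurent_uminus: "refl_laurent (- f) = - refl_laurent f"
  by (rule poly_mapping_eqI) (simp add: lookup_refl_laurent)

lemma theta_laurent_refl_laurent: "theta_laurent (refl_laurent f) = - refl_laurent (theta_laurent f)"
  by (rule poly_mapping_eqI) (simp add: lookup_refl_laurent lookup_theta_laurent)

lemma s_act_add: "s_act (p + q) = s_act p + s_act q"
proof (cases p; cases q)
  fix a b c d :: laurent
  assume "p = Fract a b" "b \<noteq> 0" "q = Fract c d" "d \<noteq> 0"
  then show ?thesis
    by (simp add: s_act_Fract refl_laurent_add refl_laurent_mult refl_laurent_eq_0_iff)
qed

lemma s_act_mult: "s_act (p * q) = s_act p * s_act q"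
proof (cases p; cases q)
  fix a b c d :: laurent
  assume "p = Fract a b" "b \<noteq> 0" "q = Fract c d" "d \<noteq> 0"
  then show ?thesis
    by (simp add: s_act_Fract refl_laurent_mult)
qed

lemma s_act_uminus: "s_act (- p) = - s_act p"
proof (cases p)
  fix a b :: laurent
  assume "p = Fract a b" "b \<noteq> 0"
  then show ?thesis
    by (simp add: s_act_Fract refl_laurent_uminus)
qed

lemma s_act_s_act: "s_act (s_act p) = p"
proof (cases p)
  fix a b :: laurent
  assume "p = Fract a b" "b \<noteq> 0"
  then show ?thesis
    by (simp add: s_act_Fract refl_laurent_refl_laurent refl_laurent_eq_0_iff)
qed

lemma s_act_to_fract: "s_act (to_fract a) = to_fract (refl_laurent a)"
  by (simp add: to_fract_def s_act_Fract refl_laurent_1)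

lemma theta_to_fract: "theta (to_fract a) = to_fract (theta_laurent a)"
  by (simp add: to_fract_def theta_Fract theta_laurent_1)

lemma s_act_cst: "s_act (cst c) = cst c"
  by (simp add: cst_def s_act_to_fract refl_laurent_single)

lemma theta_cst: "theta (cst c) = 0"
  by (simp add: cst_def theta_to_fract theta_laurent_single)

lemma cst_0: "cst 0 = 0" and cst_1: "cst 1 = 1"
  by (simp_all add: cst_def)

lemma cst_add: "cst (a + b) = cst a + cst b"
  by (simp add: cst_def single_add)

lemma cst_uminus: "cst (- a) = - cst a"
  by (simp add: cst_def single_uminus)

lemma cst_diff: "cst (a - b) = cst a - cst b"
  using cst_add[of a "- b"] by (simp add: cst_uminus)

lemma cst_mult: "cst (a * b) = cst a * cst b"
  by (simp add: cst_def mult_single flip: to_fract_mult)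

lemma cst_of_nat: "cst (of_nat n) = of_nat n"
  by (induction n) (simp_all add: cst_0 cst_1 cst_add)

lemma cst_numeral: "cst (numeral n) = numeral n"
  using cst_of_nat[of "numeral n"] by simp

lemma cst_power: "cst (a ^ n) = cst a ^ n"
  by (induction n) (simp_all add: cst_1 cst_mult)

lemma cst_inverse: "cst (inverse a) = inverse (cst a)"
proof (cases "a = 0")
  case False
  then have "cst a * cst (inverse a) = 1"
    by (simp add: cst_1 flip: cst_mult)
  then show ?thesis
    by (simp add: inverse_unique)
qed (simp add: cst_0)

lemma cst_divide: "cst (a / b) = cst a / cst b"
  by (simp add: divide_inverse cst_mult cst_inverse)

lemmas cst_hom = cst_0 cst_1 cst_add cst_uminus cst_diff cst_mult cst_numeral cst_divide

lemma s_act_0: "s_act 0 = 0" and s_act_1: "s_act 1 = 1"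
  and s_act_numeral: "s_act (numeral n) = numeral n"
  using s_act_cst[of 0] s_act_cst[of 1] s_act_cst[of "numeral n"] by (simp_all add: cst_hom)

lemma s_act_diff: "s_act (p - q) = s_act p - s_act q"
  using s_act_add[of p "- q"] by (simp add: s_act_uminus)

lemma s_act_inverse: "s_act (inverse p) = inverse (s_act p)"
proof (cases "p = 0")
  case False
  then have "s_act p * s_act (inverse p) = 1"
    by (simp add: s_act_1 flip: s_act_mult)
  then show ?thesis
    by (simp add: inverse_unique)
qed (simp add: s_act_0)

lemma s_act_divide: "s_act (p / q) = s_act p / s_act q"
  by (simp add: divide_inverse s_act_mult s_act_inverse)

lemma s_act_power: "s_act (p ^ n) = s_act p ^ n"
  by (induction n) (simp_all add: s_act_1 s_act_mult)

lemma s_act_Z: "s_act Z = inverse Z"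
proof -
  have "to_fract (Poly_Mapping.single 1 1 :: laurent) * to_fract (Poly_Mapping.single (-1) 1) = 1"
    by (simp add: mult_single flip: to_fract_mult)
  then show ?thesis
    by (simp add: Z_def s_act_to_fract refl_laurent_single inverse_unique)
qed

lemmas s_act_hom = s_act_0 s_act_1 s_act_numeral s_act_add s_act_uminus s_act_diff s_act_mult
  s_act_inverse s_act_divide s_act_power s_act_cst s_act_Z

lemma theta_add: "theta (p + q) = theta p + theta q"
proof (cases p; cases q)
  fix a b c d :: laurent
  assume "p = Fract a b" "b \<noteq> 0" "q = Fract c d" "d \<noteq> 0"
  then show ?thesis
    by (simp add: theta_Fract theta_laurent_add theta_laurent_mult eq_fract) (simp add: algebra_simps)
qed

lemma theta_mult: "theta (p * q) = theta p * q + p * theta q"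
proof (cases p; cases q)
  fix a b c d :: laurent
  assume "p = Fract a b" "b \<noteq> 0" "q = Fract c d" "d \<noteq> 0"
  then show ?thesis
    by (simp add: theta_Fract theta_laurent_add theta_laurent_mult eq_fract) (simp add: algebra_simps)
qed

lemma theta_s_act: "theta (s_act p) = - s_act (theta p)"
proof (cases p)
  fix a b :: laurent
  assume "p = Fract a b" "b \<noteq> 0"
  then show ?thesis
    by (simp add: s_act_Fract theta_Fract theta_laurent_refl_laurent refl_laurent_mult
        refl_laurent_add refl_laurent_uminus refl_laurent_eq_0_iff
        diff_conv_add_uminus del: add_uminus_conv_diff)
qed

lemma theta_0: "theta 0 = 0" and theta_1: "theta 1 = 0"
  and theta_numeral: "theta (numeral n) = 0"
  using theta_cst[of 0] theta_cst[of 1] theta_cst[of "numeral n"] by (simp_all add: cst_hom)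

lemma theta_uminus: "theta (- p) = - theta p"
  using theta_mult[of "- 1" p] theta_cst[of "- 1"] by (simp add: cst_hom)

lemma theta_diff: "theta (p - q) = theta p - theta q"
  using theta_add[of p "- q"] by (simp add: theta_uminus)

lemma theta_inverse: "theta (inverse p) = - theta p / p ^ 2"
proof (cases "p = 0")
  case False
  have "theta p * inverse p + p * theta (inverse p) = 0"
    using theta_mult[of p "inverse p"] False by (simp add: theta_1)
  with False show ?thesis
    by (simp add: field_simps power2_eq_square eq_neg_iff_add_eq_0)
qed (simp add: theta_0)

lemma theta_divide: "q \<noteq> 0 \<Longrightarrow> theta (p / q) = (theta p * q - p * theta q) / q ^ 2"
  by (simp only: divide_inverse[of p q] theta_mult theta_inverse)
    (simp add: field_simps power2_eq_square)

lemma theta_power: "theta (p ^ n) = of_nat n * p ^ (n - 1) * theta p"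
proof (induction n)
  case (Suc n)
  then show ?case
    by (cases n) (simp_all add: theta_mult algebra_simps)
qed (simp add: theta_1)

lemma theta_Z: "theta Z = Z"
  by (simp add: Z_def theta_to_fract theta_laurent_single)

lemmas theta_rules = theta_0 theta_1 theta_numeral theta_add theta_uminus theta_diff theta_mult
  theta_cst theta_Z theta_power

lemma theta_scale: "theta (cst c * p) = cst c * theta p"
  by (simp add: theta_rules)

text \<open>
  A constant has derivative \<open>0\<close>, whereas \<open>z\<close> is its own derivative: if \<open>z\<close> were constant, it would be \<open>0\<close>.
\<close>

lemma Z_nonzero: "Z \<noteq> 0" and Z_neq_1: "Z \<noteq> 1" and Z_neq_minus_1: "Z \<noteq> - 1"
proof -
  have *: "Z \<noteq> cst c" for c
  proof
    assume "Z = cst c"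
    then have "Z = 0"
      using theta_Z theta_cst[of c] by simp
    then have "Poly_Mapping.lookup (Poly_Mapping.single (1 :: int) (1 :: complex)) 1 = 0"
      unfolding Z_def to_fract_eq_0_iff by simp
    then show False
      by simp
  qed
  show "Z \<noteq> 0" "Z \<noteq> 1" "Z \<noteq> - 1"
    using *[of 0] *[of 1] *[of "- 1"] by (simp_all add: cst_hom)
qed

lemma Z_square_neq_1: "Z ^ 2 \<noteq> 1"
  using Z_neq_1 Z_neq_minus_1 by (simp add: power2_eq_1_iff)

lemma Z_plus_1_nonzero: "Z + 1 \<noteq> 0"
  using Z_neq_minus_1 by (simp add: add_eq_0_iff2)

lemma Z_square_minus_1_eq: "Z ^ 2 - 1 = (Z - 1) * (Z + 1)"
  by algebra

lemma Delta_eq: "Delta = (Z ^ 2 - 1) / Z"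
  using Z_nonzero by (simp add: Delta_def field_simps power2_eq_square)

lemma Delta_nonzero: "Delta \<noteq> 0"
  using Z_nonzero Z_square_neq_1 by (simp add: Delta_eq)

section \<open>The decomposition of Laurent polynomials over the symmetric ones\<close>

definition eval_X :: "complex poly \<Rightarrow> ratfun" where
  "eval_X p = poly (map_poly cst p) X"

lemma Poly_x_eq: "Poly_x = range eval_X"
  by (auto simp: Poly_x_def eval_X_def)

lemma eval_X_0: "eval_X 0 = 0"
  by (simp add: eval_X_def)

lemma eval_X_pCons: "eval_X (pCons c p) = cst c + X * eval_X p"
  by (cases "c = 0 \<and> p = 0") (auto simp: eval_X_def map_poly_pCons cst_0)

lemma eval_X_add: "eval_X (p + q) = eval_X p + eval_X q"
proof -
  have "map_poly cst (p + q) = map_poly cst p + map_poly cst q"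
    by (rule poly_eqI) (simp add: coeff_map_poly cst_hom)
  then show ?thesis
    by (simp add: eval_X_def)
qed

lemma eval_X_smult: "eval_X (smult c p) = cst c * eval_X p"
  by (induction p) (simp_all add: eval_X_0 eval_X_pCons cst_hom algebra_simps)

lemma eval_X_mult: "eval_X (p * q) = eval_X p * eval_X q"
  by (induction p) (simp_all add: eval_X_0 eval_X_pCons eval_X_add eval_X_smult cst_hom algebra_simps)

lemma Poly_x_add: "p \<in> Poly_x \<Longrightarrow> q \<in> Poly_x \<Longrightarrow> p + q \<in> Poly_x"
  by (auto simp: Poly_x_eq simp flip: eval_X_add)

lemma Poly_x_mult: "p \<in> Poly_x \<Longrightarrow> q \<in> Poly_x \<Longrightarrow> p * q \<in> Poly_x"
  by (auto simp: Poly_x_eq simp flip: eval_X_mult)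

lemma Poly_x_cst: "cst c \<in> Poly_x"
  using eval_X_pCons[of c 0] by (metis Poly_x_eq eval_X_0 add_0_right mult_zero_right rangeI)

lemma Poly_x_0: "0 \<in> Poly_x" and Poly_x_1: "1 \<in> Poly_x"
  and Poly_x_numeral: "numeral n \<in> Poly_x"
  using Poly_x_cst[of 0] Poly_x_cst[of 1] Poly_x_cst[of "numeral n"] by (simp_all add: cst_hom)

lemma Poly_x_uminus: "p \<in> Poly_x \<Longrightarrow> - p \<in> Poly_x"
  using Poly_x_mult[OF Poly_x_cst[of "- 1"]] by (simp add: cst_hom)

lemma Poly_x_diff: "p \<in> Poly_x \<Longrightarrow> q \<in> Poly_x \<Longrightarrow> p - q \<in> Poly_x"
  using Poly_x_add[OF _ Poly_x_uminus] by fastforce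

lemma Poly_x_X: "X \<in> Poly_x"
  using eval_X_pCons[of 0 "[:1:]"] eval_X_pCons[of 1 0]
  by (metis Poly_x_eq cst_0 cst_1 eval_X_0 add_0_left add_0_right mult_1_right mult_zero_right rangeI)

lemma Poly_x_half: "p \<in> Poly_x \<Longrightarrow> p / 2 \<in> Poly_x"
  using Poly_x_mult[OF Poly_x_cst[of "1 / 2"]] by (simp add: cst_hom)

lemmas Poly_x_intros = Poly_x_add Poly_x_mult Poly_x_cst Poly_x_0 Poly_x_1 Poly_x_numeral
  Poly_x_uminus Poly_x_diff Poly_x_X Poly_x_half

lemma s_act_Poly_x:
  assumes "p \<in> Poly_x"
  shows "s_act p = p"
proof -
  have "s_act (eval_X q) = eval_X q" for q
    by (induction q) (simp_all add: eval_X_0 eval_X_pCons s_act_hom X_def add.commute)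
  then show ?thesis
    using assms by (auto simp: Poly_x_eq)
qed

text \<open>
  Chain rule: \<open>z\<partial>\<^sub>z x = \<Delta> / 2\<close>. The factor \<open>\<Delta>\<close> cancels the poles of the coefficients
  of \<open>z\<partial>\<^sub>z\<close> in \<open>G\<^sub>+\<close> and \<open>E\<^sub>\<plusminus>\<close>.
\<close>

lemma theta_Poly_x:
  assumes "p \<in> Poly_x"
  obtains p' where "p' \<in> Poly_x" "theta p = Delta / 2 * p'"
proof -
  have X: "theta X = Delta / 2"
    using Z_nonzero
    by (simp add: X_def theta_divide theta_rules theta_inverse Delta_eq field_simps power2_eq_square)
  have "theta (eval_X q) = Delta / 2 * eval_X (pderiv q)" for q
    by (induction q)
      (simp_all add: eval_X_0 eval_X_pCons pderiv_pCons eval_X_add theta_rules X cst_0 algebra_simps)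
  then show ?thesis
    using assms that by (auto simp: Poly_x_eq)
qed

lemma Laurent_add: "p \<in> Laurent \<Longrightarrow> q \<in> Laurent \<Longrightarrow> p + q \<in> Laurent"
  by (auto simp: Laurent_def simp flip: to_fract_add)

lemma Laurent_mult: "p \<in> Laurent \<Longrightarrow> q \<in> Laurent \<Longrightarrow> p * q \<in> Laurent"
  by (auto simp: Laurent_def simp flip: to_fract_mult)

lemma Laurent_uminus: "p \<in> Laurent \<Longrightarrow> - p \<in> Laurent"
  by (auto simp: Laurent_def simp flip: to_fract_uminus)

lemma Laurent_diff: "p \<in> Laurent \<Longrightarrow> q \<in> Laurent \<Longrightarrow> p - q \<in> Laurent"
  by (auto simp: Laurent_def simp flip: to_fract_diff)

lemma Laurent_cst: "cst c \<in> Laurent" and Laurent_Z: "Z \<in> Laurent"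
  by (simp_all add: Laurent_def cst_def Z_def)

lemma Laurent_inverse_Z: "inverse Z \<in> Laurent"
  unfolding Laurent_def using s_act_Z by (metis Z_def s_act_to_fract rangeI)

lemma Laurent_0: "0 \<in> Laurent" and Laurent_1: "1 \<in> Laurent"
  using Laurent_cst[of 0] Laurent_cst[of 1] by (simp_all add: cst_hom)

lemma Laurent_power: "p \<in> Laurent \<Longrightarrow> p ^ n \<in> Laurent"
  by (induction n) (simp_all add: Laurent_1 Laurent_mult)

lemmas Laurent_intros = Laurent_add Laurent_mult Laurent_uminus Laurent_diff Laurent_cst Laurent_Z
  Laurent_inverse_Z Laurent_0 Laurent_1 Laurent_power

lemma Poly_x_subset_Laurent: "Poly_x \<subseteq> Laurent"
proof -
  have "X = cst (1 / 2) * (Z + inverse Z)"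
    by (simp add: X_def cst_hom)
  then have X: "X \<in> Laurent"
    by (metis Laurent_add Laurent_mult Laurent_cst Laurent_Z Laurent_inverse_Z)
  have "eval_X q \<in> Laurent" for q
    by (induction q) (auto simp: eval_X_0 eval_X_pCons X intro!: Laurent_intros)
  then show ?thesis
    by (auto simp: Poly_x_eq)
qed

text \<open>
  Since \<open>z\<^sup>2 = 2 x z - 1\<close> and \<open>z\<^sup>-\<^sup>1 = 2 x - z\<close>, the module \<open>\<complex>[x] + \<complex>[x] z\<close> is stable under
  multiplication by \<open>z\<close> and by \<open>z\<^sup>-\<^sup>1\<close>; as it contains the constants, it contains every monomial.
\<close>

lemma Laurent_decomposition:
  assumes "f \<in> Laurent"
  obtains f1 f2 where "f1 \<in> Poly_x" "f2 \<in> Poly_x" "f = f1 + f2 * Z"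
proof -
  let ?M = "{f1 + f2 * Z | f1 f2. f1 \<in> Poly_x \<and> f2 \<in> Poly_x}"
  have Z_mult: "Z * p \<in> ?M" if "p \<in> ?M" for p
  proof -
    from that obtain f1 f2 where f: "f1 \<in> Poly_x" "f2 \<in> Poly_x" "p = f1 + f2 * Z"
      by blast
    have "Z * p = - f2 + (f1 + 2 * X * f2) * Z"
      using Z_nonzero by (simp add: f X_def field_simps)
    then show ?thesis
      using f by (blast intro: Poly_x_intros)
  qed
  have inverse_Z_mult: "inverse Z * p \<in> ?M" if "p \<in> ?M" for p
  proof -
    from that obtain f1 f2 where f: "f1 \<in> Poly_x" "f2 \<in> Poly_x" "p = f1 + f2 * Z"
      by blast
    have "inverse Z * p = (2 * X * f1 + f2) + (- f1) * Z"
      using Z_nonzero by (simp add: f X_def field_simps)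
    then show ?thesis
      using f by (blast intro: Poly_x_intros)
  qed
  have "to_fract (Poly_Mapping.single n c) \<in> ?M" for n c
  proof (induction n rule: int_induct[where k = 0])
    case base
    have "cst c = cst c + 0 * Z"
      by simp
    then show ?case
      unfolding cst_def[symmetric] by (blast intro: Poly_x_intros)
  next
    case (step1 i)
    have "to_fract (Poly_Mapping.single (i + 1) c) = Z * to_fract (Poly_Mapping.single i c)"
      by (simp add: Z_def mult_single add.commute flip: to_fract_mult)
    with Z_mult[OF step1(2)] show ?case
      by simp
  next
    case (step2 i)
    have "Z * to_fract (Poly_Mapping.single (i - 1) c) = to_fract (Poly_Mapping.single i c)"
      by (simp add: Z_def mult_single flip: to_fract_mult)
    then have "to_fract (Poly_Mapping.single (i - 1) c)
        = inverse Z * to_fract (Poly_Mapping.single i c)"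
      using Z_nonzero by (metis mult.assoc left_inverse mult_1_left)
    with inverse_Z_mult[OF step2(2)] show ?case
      by simp
  qed
  then have "to_fract a \<in> ?M" for a
  proof (induction a rule: laurent_induct)
    case 1
    have "0 + 0 * Z \<in> ?M"
      by (blast intro: Poly_x_0)
    then show ?case
      by (simp only: to_fract_0 mult_zero_left add_0_left)
  next
    case (2 f g)
    then obtain f1 f2 g1 g2 where *: "f1 \<in> Poly_x" "f2 \<in> Poly_x" "g1 \<in> Poly_x" "g2 \<in> Poly_x"
      "to_fract f = f1 + f2 * Z" "to_fract g = g1 + g2 * Z"
      by blast
    then have "to_fract (f + g) = (f1 + g1) + (f2 + g2) * Z"
      by (simp add: algebra_simps)
    with * show ?case
      by (blast intro: Poly_x_intros)
  qed
  then show ?thesis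
    using assms that by (auto simp: Laurent_def)
qed

text \<open>
  Applying \<open>s\<close> to \<open>f\<^sub>1 + f\<^sub>2 z\<close> fixes \<open>f\<^sub>1\<close> and \<open>f\<^sub>2\<close>, so that \<open>f - s f = f\<^sub>2 \<Delta>\<close> recovers \<open>f\<^sub>2\<close>.
\<close>

lemma Poly_x_components_unique:
  assumes "f1 \<in> Poly_x" "f2 \<in> Poly_x" "g1 \<in> Poly_x" "g2 \<in> Poly_x"
    and eq: "f1 + f2 * Z = g1 + g2 * Z"
  shows "f1 = g1 \<and> f2 = g2"
proof -
  have "f1 + f2 * inverse Z = g1 + g2 * inverse Z"
    using arg_cong[OF eq, of s_act] assms(1-4) by (simp add: s_act_hom s_act_Poly_x)
  then have "f2 * Delta = g2 * Delta"
    using eq unfolding Delta_def by algebra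
  then show ?thesis
    using eq Delta_nonzero by simp
qed

lemma Upsilon_eq:
  assumes "f1 \<in> Poly_x" "f2 \<in> Poly_x"
  shows "Upsilon (f1 + f2 * Z) = vector [f1, f2]"
  unfolding Upsilon_def
proof (rule the_equality)
  show "(vector [f1, f2] :: ratfun ^ 2) $ 1 \<in> Poly_x \<and> (vector [f1, f2] :: ratfun ^ 2) $ 2 \<in> Poly_x
    \<and> f1 + f2 * Z = (vector [f1, f2] :: ratfun ^ 2) $ 1 + (vector [f1, f2] :: ratfun ^ 2) $ 2 * Z"
    using assms by simp
next
  fix v :: "ratfun ^ 2"
  assume "v $ 1 \<in> Poly_x \<and> v $ 2 \<in> Poly_x \<and> f1 + f2 * Z = v $ 1 + v $ 2 * Z"
  then have "f1 = v $ 1 \<and> f2 = v $ 2"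
    using assms Poly_x_components_unique by blast
  then show "v = vector [f1, f2]"
    by (simp add: vec_eq_iff forall_2)
qed

lemma Laurent_of_components: "f1 \<in> Poly_x \<Longrightarrow> f2 \<in> Poly_x \<Longrightarrow> f1 + f2 * Z \<in> Laurent"
  using Poly_x_subset_Laurent by (blast intro: Laurent_intros)

lemma inj_on_Upsilon: "inj_on Upsilon Laurent"
proof (rule inj_onI)
  fix f g
  assume "f \<in> Laurent" "g \<in> Laurent" and eq: "Upsilon f = Upsilon g"
  then obtain f1 f2 g1 g2 where *: "f1 \<in> Poly_x" "f2 \<in> Poly_x" "g1 \<in> Poly_x" "g2 \<in> Poly_x"
      "f = f1 + f2 * Z" "g = g1 + g2 * Z"
    by (metis Laurent_decomposition)
  then have "(vector [f1, f2] :: ratfun ^ 2) = vector [g1, g2]"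
    using eq by (simp add: Upsilon_eq)
  then show "f = g"
    using * by (metis vector_2)
qed

lemma inv_Upsilon_eq:
  assumes "f1 \<in> Poly_x" "f2 \<in> Poly_x"
  shows "inv_into Laurent Upsilon (vector [f1, f2]) = f1 + f2 * Z"
  using inv_into_f_f[OF inj_on_Upsilon Laurent_of_components[OF assms]] Upsilon_eq[OF assms]
  by simp

section \<open>Faithfulness of the action on Laurent polynomials\<close>

text \<open>
  The difference operator \<open>u \<mapsto> u(n + 1) - u(n)\<close> preserves the shape \<open>p(n) + q(n) w\<^sup>n\<close>: it sends \<open>p\<close> to
  its forward difference, of smaller degree, and \<open>q\<close> to \<open>w q(x + 1) - q(x)\<close>, whose leading coefficient
  is \<open>w - 1\<close> times that of \<open>q\<close>. Induction on the degree of \<open>p\<close> therefore kills \<open>q\<close>, and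
  \<open>p\<close> is then a polynomial with infinitely many zeros.
\<close>

lemma poly_plus_poly_times_power_eq_0:
  fixes p q :: "'a :: field_char_0 poly"
  assumes w: "w \<noteq> 0" "w \<noteq> 1"
    and zero: "\<And>n. poly p (of_nat n) + poly q (of_nat n) * w ^ n = 0"
  shows "p = 0 \<and> q = 0"
proof -
  have vanish: "r = 0" if "\<And>n. poly r (of_nat n) = 0" for r :: "'a poly"
  proof (rule ccontr)
    assume "r \<noteq> 0"
    then have "finite {x. poly r x = 0}"
      by (rule poly_roots_finite)
    moreover have "range (of_nat :: nat \<Rightarrow> 'a) \<subseteq> {x. poly r x = 0}"
      using that by auto
    ultimately show False
      using finite_subset inj_of_nat range_inj_infinite by blast
  qed
  have "q = 0"
    using zero
  proof (induction "degree p" arbitrary: p q rule: less_induct)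
    case less
    show ?case
    proof (cases "p = 0")
      case True
      then show ?thesis
        using vanish[of q] less.prems w by simp
    next
      case False
      define dp where "dp = pcompose p [:1, 1:] - p"
      define dq where "dq = smult w (pcompose q [:1, 1:]) - q"
      have "poly dp (of_nat n) + poly dq (of_nat n) * w ^ n
          = (poly p (of_nat (Suc n)) + poly q (of_nat (Suc n)) * w ^ Suc n)
            - (poly p (of_nat n) + poly q (of_nat n) * w ^ n)" for n
        by (simp add: dp_def dq_def poly_pcompose algebra_simps)
      then have d: "poly dp (of_nat n) + poly dq (of_nat n) * w ^ n = 0" for n
        using less.prems[of n] less.prems[of "Suc n"] by simp
      have lead: "coeff (pcompose r [:1, 1:]) (degree r) = coeff r (degree r)" for r :: "'a poly"
        using lead_coeff_comp[of "[:1, 1:]" r] by (simp add: degree_pcompose)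
      have "dq = 0"
      proof (cases "dp = 0")
        case True
        then show ?thesis
          using vanish[of dq] d w by simp
      next
        case False
        have "degree dp \<le> degree p"
          unfolding dp_def by (intro degree_diff_le) (simp_all add: degree_pcompose)
        moreover have "coeff dp (degree p) = 0"
          by (simp add: dp_def lead)
        ultimately have "degree dp < degree p"
          using False by (metis leading_coeff_0_iff order_le_less)
        then show ?thesis
          using less.hyps d by blast
      qed
      then have "coeff dq (degree q) = 0"
        by simp
      then have "(w - 1) * coeff q (degree q) = 0"
        by (simp add: dq_def lead algebra_simps)
      then show ?thesis
        using w by simp
    qed
  qed
  then show ?thesis
    using vanish[of p] zero by simp
qed

lemma theta_funpow_Z_power: "(theta ^^ j) (Z ^ n) = of_nat n ^ j * Z ^ n"
proof (induction j)
  case (Suc j)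
  have "theta (Z ^ n) = of_nat n * Z ^ n"
    unfolding theta_power theta_Z by (cases n) simp_all
  moreover have "theta (of_nat n ^ j * p) = of_nat n ^ j * theta p" for p
    using theta_scale[of "of_nat n ^ j" p] by (simp add: cst_of_nat cst_power)
  ultimately show ?case
    using Suc by simp
qed simp

lemma theta_funpow_inverse_Z_power:
  "(theta ^^ j) (inverse Z ^ n) = (- of_nat n) ^ j * inverse Z ^ n"
proof (induction j)
  case (Suc j)
  have "theta (inverse Z) = - inverse Z"
    using Z_nonzero unfolding theta_inverse theta_Z by (simp add: field_simps power2_eq_square)
  then have "theta (inverse Z ^ n) = - of_nat n * inverse Z ^ n"
    unfolding theta_power by (cases n) (simp_all add: algebra_simps)
  moreover have "theta ((- of_nat n) ^ j * p) = (- of_nat n) ^ j * theta p" for p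
    using theta_scale[of "(- of_nat n) ^ j" p] by (simp add: cst_of_nat cst_uminus cst_power)
  ultimately show ?case
    using Suc by simp
qed simp

text \<open>
  On \<open>z\<^sup>n\<close> the operator \<open>\<Sum>\<^sub>j a\<^sub>j \<theta>\<^sup>j + b\<^sub>j \<theta>\<^sup>j s\<close> takes the value \<open>p(n) z\<^sup>n + q(-n) z\<^sup>-\<^sup>n\<close>, where \<open>p\<close> and
  \<open>q\<close> are the polynomials with coefficients \<open>a\<^sub>j\<close> and \<open>b\<^sub>j\<close>. As \<open>z\<^sup>-\<^sup>2 \<noteq> 1\<close>, these values determine
  \<open>p\<close> and \<open>q\<close>.
\<close>

lemma diff_refl_ops_eqI:
  assumes "S \<in> diff_refl_ops" "T \<in> diff_refl_ops"
    and eq: "\<And>f. f \<in> Laurent \<Longrightarrow> S f = T f"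
  shows "S = T"
proof -
  have pad: "\<exists>n. \<forall>N\<ge>n. \<exists>a b. R = (\<lambda>f. \<Sum>j<N. a j * (theta ^^ j) f + b j * (theta ^^ j) (s_act f))"
    if R: "R \<in> diff_refl_ops" for R
  proof -
    from R obtain n a b where
      R: "R = (\<lambda>f. \<Sum>j<n. a j * (theta ^^ j) f + b j * (theta ^^ j) (s_act f))"
      unfolding diff_refl_ops_def by blast
    show ?thesis
    proof (intro exI allI impI)
      fix N
      assume "n \<le> N"
      then show "R = (\<lambda>f. \<Sum>j<N. (if j < n then a j else 0) * (theta ^^ j) f
          + (if j < n then b j else 0) * (theta ^^ j) (s_act f))"
        unfolding R by (intro ext sum.mono_neutral_cong_left) auto
    qed
  qed
  obtain n m where
    n: "\<forall>N\<ge>n. \<exists>a b. S = (\<lambda>f. \<Sum>j<N. a j * (theta ^^ j) f + b j * (theta ^^ j) (s_act f))" and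
    m: "\<forall>N\<ge>m. \<exists>a b. T = (\<lambda>f. \<Sum>j<N. a j * (theta ^^ j) f + b j * (theta ^^ j) (s_act f))"
    using pad[OF assms(1)] pad[OF assms(2)] by blast
  define N where "N = max n m"
  obtain a b c d where
    S: "S = (\<lambda>f. \<Sum>j<N. a j * (theta ^^ j) f + b j * (theta ^^ j) (s_act f))" and
    T: "T = (\<lambda>f. \<Sum>j<N. c j * (theta ^^ j) f + d j * (theta ^^ j) (s_act f))"
    using n m unfolding N_def by (meson max.cobounded1 max.cobounded2)
  define p where "p = (\<Sum>j<N. monom (a j - c j) j)"
  \<comment> \<open>The sign \<open>(- 1)\<^sup>j\<close> makes the value at \<open>n\<close> the one at \<open>- n\<close>.\<close>
  define q where "q = (\<Sum>j<N. monom ((- 1) ^ j * (b j - d j)) j)"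
  have "poly p (of_nat i) + poly q (of_nat i) * (inverse Z ^ 2) ^ i = 0" for i
  proof -
    have "S (Z ^ i) - T (Z ^ i) = 0"
      using eq[of "Z ^ i"] by (simp add: Laurent_intros)
    moreover have "S (Z ^ i) - T (Z ^ i)
        = poly p (of_nat i) * Z ^ i + poly q (of_nat i) * inverse Z ^ i"
      unfolding S T p_def q_def poly_sum poly_monom sum_distrib_right
        sum.distrib[symmetric] sum_subtractf[symmetric] s_act_power s_act_Z
        theta_funpow_Z_power theta_funpow_inverse_Z_power
      by (intro sum.cong refl) (simp add: power_minus[of "of_nat i"] algebra_simps)
    ultimately have
      "(poly p (of_nat i) * Z ^ i + poly q (of_nat i) * inverse Z ^ i) * inverse Z ^ i = 0"
      by simp
    moreover have "Z ^ i * inverse Z ^ i = 1"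
      using Z_nonzero by (simp flip: power_mult_distrib)
    moreover have "(inverse Z ^ 2) ^ i = inverse Z ^ i * inverse Z ^ i"
      by (simp add: power2_eq_square power_mult_distrib)
    ultimately show ?thesis
      by (simp add: distrib_right mult.assoc)
  qed
  moreover have "inverse Z ^ 2 \<noteq> 0" "inverse Z ^ 2 \<noteq> 1"
    using Z_nonzero Z_square_neq_1 by (simp_all add: power_inverse)
  ultimately have "p = 0 \<and> q = 0"
    using poly_plus_poly_times_power_eq_0 by blast
  moreover have "coeff p j = a j - c j" "coeff q j = (- 1) ^ j * (b j - d j)" if "j < N" for j
    using that by (simp_all add: p_def q_def coeff_sum)
  ultimately have "a j = c j" "b j = d j" if "j < N" for j
    using that by auto
  then show ?thesis
    unfolding S T by (intro ext sum.cong) auto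
qed

lemma Laurent_Delta_of_Laurent: "f \<in> Laurent \<Longrightarrow> f / Delta ^ m \<in> Laurent_Delta"
  by (auto simp: Laurent_Delta_def)

lemma Laurent_subset_Laurent_Delta: "Laurent \<subseteq> Laurent_Delta"
  using Laurent_Delta_of_Laurent[of _ 0] by auto

lemma first_order_in_diff_refl_ops:
  assumes "p \<in> Laurent_Delta" "q \<in> Laurent_Delta" "r \<in> Laurent_Delta"
  shows "(\<lambda>f. p * theta f + q * f + r * s_act f) \<in> diff_refl_ops"
proof -
  have "(\<lambda>f. p * theta f + q * f + r * s_act f)
      = (\<lambda>f. \<Sum>j<2. (if j = 0 then q else p) * (theta ^^ j) f
          + (if j = 0 then r else 0) * (theta ^^ j) (s_act f))"
    by (simp add: fun_eq_iff numeral_2_eq_2)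
  moreover have "0 \<in> Laurent_Delta"
    using Laurent_subset_Laurent_Delta Laurent_0 by blast
  ultimately show ?thesis
    unfolding diff_refl_ops_def using assms
    by (intro CollectI exI[of _ 2] exI[of _ "\<lambda>j. if j = 0 then q else p"]
        exI[of _ "\<lambda>j. if j = 0 then r else 0"]) auto
qed

section \<open>Pullbacks of the conjugated matrix operators\<close>

lemma mat2_nth:
  "mat2 a b c d $ 1 $ 1 = a" "mat2 a b c d $ 1 $ 2 = b"
  "mat2 a b c d $ 2 $ 1 = c" "mat2 a b c d $ 2 $ 2 = d"
  by (simp_all add: mat2_def)

lemma matrix_inv_eqI:
  fixes A B :: "'a :: semiring_1 ^ 'n ^ 'n"
  assumes "A ** B = mat 1" "B ** A = mat 1"
  shows "matrix_inv A = B"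
proof -
  have "\<exists>C :: 'a ^ 'n ^ 'n. A ** C = mat 1 \<and> C ** A = mat 1"
    using assms by blast
  then have "matrix_inv A ** A = mat 1"
    unfolding matrix_inv_def by (rule someI2_ex) simp
  then show ?thesis
    using assms by (metis matrix_mul_assoc matrix_mul_lid matrix_mul_rid)
qed

lemma matrix_inv_U_mat:
  fixes r :: complex
  defines "r \<equiv> 1 / complex_of_real (sqrt 2)"
  shows "matrix_inv U_mat = mat2 r r (- r) r"
proof (rule matrix_inv_eqI)
  have "complex_of_real (sqrt 2) * complex_of_real (sqrt 2) = 2"
    by (simp flip: of_real_mult)
  then have r: "r * r = 1 / 2"
    by (simp add: r_def)
  have U: "U_mat = mat2 r (- r) r r"
    by (simp add: U_mat_def r_def Let_def)
  show "U_mat ** mat2 r r (- r) r = mat 1" "mat2 r r (- r) r ** U_mat = mat 1"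
    by (simp_all add: U vec_eq_iff forall_2 matrix_matrix_mult_def sum_2 mat2_nth mat_def r)
qed

text \<open>
  The two factors \<open>1/\<surd>2\<close> of \<open>U\<close> and \<open>U\<^sup>-\<^sup>1\<close> combine to \<open>1/2\<close> because the entries commute with scalars.
\<close>

lemma conj_U_mat2:
  assumes "\<And>t f. a (cst t * f) = cst t * a f" "\<And>t f. b (cst t * f) = cst t * b f"
    and "\<And>t f. c (cst t * f) = cst t * c f" "\<And>t f. d (cst t * f) = cst t * d f"
  shows "conj_U (mat2 a b c d) (vector [f1, f2]) = vector
    [(a (f1 - f2) + b (f1 + f2) + (c (f1 - f2) + d (f1 + f2))) / 2,
     (c (f1 - f2) + d (f1 + f2) - (a (f1 - f2) + b (f1 + f2))) / 2]"
proof -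
  define r :: complex where "r = 1 / complex_of_real (sqrt 2)"
  have "complex_of_real (sqrt 2) * complex_of_real (sqrt 2) = 2"
    by (simp flip: of_real_mult)
  then have "r * r = 1 / 2"
    by (simp add: r_def)
  then have "cst r * cst r = cst (1 / 2)"
    by (simp only: flip: cst_mult)
  then have half: "cst r * (cst r * f) = f / 2" for f
    by (simp add: cst_divide cst_1 cst_numeral flip: mult.assoc)
  have U: "scalar_mat_act U_mat (vector [f1, f2]) = vector [cst r * (f1 - f2), cst r * (f1 + f2)]"
    by (simp add: scalar_mat_act_def U_mat_def Let_def vec_eq_iff forall_2 sum_2 mat2_nth
        cst_uminus algebra_simps flip: r_def)
  have inv: "scalar_mat_act (matrix_inv U_mat) v
      = vector [cst r * (v $ 1 + v $ 2), cst r * (v $ 2 - v $ 1)]" for v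
    by (simp add: scalar_mat_act_def matrix_inv_U_mat vec_eq_iff forall_2 sum_2 mat2_nth
        cst_uminus algebra_simps flip: r_def)
  show ?thesis
    by (simp add: conj_U_def U inv op_mat_act_def sum_2 mat2_nth assms half
        flip: distrib_left right_diff_distrib)
qed

text \<open>
  An identity on the components \<open>f\<^sub>1, f\<^sub>2 \<in> \<complex>[x]\<close> gives everything but the intertwining relation:
  by faithfulness the pullback is unique, and it preserves \<open>\<complex>[z\<^sup>\<plusminus>\<^sup>1]\<close> because its components are
  again in \<open>\<complex>[x]\<close>.
\<close>

lemma is_pullback_iff_and_Laurent:
  assumes S0: "S0 \<in> diff_refl_ops"
    and comps: "\<And>f1 f2. f1 \<in> Poly_x \<Longrightarrow> f2 \<in> Poly_x \<Longrightarrow>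
      \<exists>h1\<in>Poly_x. \<exists>h2\<in>Poly_x. A (vector [f1, f2]) = vector [h1, h2] \<and> S0 (f1 + f2 * Z) = h1 + h2 * Z"
  shows "(is_pullback A S \<longleftrightarrow> S = S0) \<and> (\<forall>f\<in>Laurent. S0 f \<in> Laurent)"
proof -
  have *: "S0 f = (inv_into Laurent Upsilon \<circ> A \<circ> Upsilon) f \<and> S0 f \<in> Laurent"
    if "f \<in> Laurent" for f
  proof -
    obtain f1 f2 where f: "f1 \<in> Poly_x" "f2 \<in> Poly_x" "f = f1 + f2 * Z"
      using \<open>f \<in> Laurent\<close> by (rule Laurent_decomposition)
    obtain h1 h2 where h: "h1 \<in> Poly_x" "h2 \<in> Poly_x" "A (vector [f1, f2]) = vector [h1, h2]"
      "S0 f = h1 + h2 * Z"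
      using comps[OF f(1,2)] f(3) by blast
    then show ?thesis
      using f by (simp add: Upsilon_eq inv_Upsilon_eq Laurent_of_components)
  qed
  then have "is_pullback A S0"
    using S0 by (simp add: is_pullback_def)
  moreover have "S = S0" if "is_pullback A S"
    using that S0 * by (intro diff_refl_ops_eqI) (auto simp: is_pullback_def)
  ultimately show ?thesis
    using * by blast
qed

section \<open>Intertwining relations\<close>

text \<open>
  The two reflection terms of the Cherednik operator over the common denominator \<open>z\<^sup>2 - 1\<close>.
\<close>

definition reflection_coeff :: "complex \<times> complex \<Rightarrow> ratfun" where
  "reflection_coeff k = (cst (fst k) * Z * (Z + 1) + 2 * cst (snd k) * Z ^ 2) / (Z ^ 2 - 1)"

lemma Cherednik_eq:
  "Cherednik k f = theta f + reflection_coeff k * (f - s_act f) - cst (rho k) * f"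
proof -
  have "1 / (1 - inverse Z) = Z * (Z + 1) / (Z ^ 2 - 1)"
    and "1 / (1 - inverse Z ^ 2) = Z ^ 2 / (Z ^ 2 - 1)"
    using Z_nonzero Z_neq_1 Z_square_neq_1 by (simp_all add: field_simps power2_eq_square)
  then show ?thesis
    unfolding Cherednik_def reflection_coeff_def
    by (simp add: algebra_simps add_divide_distrib)
qed

lemma s_act_reflection_coeff:
  "s_act (reflection_coeff k) = - (cst (fst k) * (Z + 1) + 2 * cst (snd k)) / (Z ^ 2 - 1)"
  using Z_nonzero Z_square_neq_1
  by (simp add: reflection_coeff_def s_act_hom divide_simps) (simp add: algebra_simps power2_eq_square)

lemma theta_reflection_coeff:
  "theta (reflection_coeff k)
    = - (cst (fst k) * Z * (Z + 1) ^ 2 + 4 * cst (snd k) * Z ^ 2) / (Z ^ 2 - 1) ^ 2"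
  using Z_square_neq_1
  by (simp add: reflection_coeff_def theta_divide theta_rules divide_simps)
    (simp add: algebra_simps power2_eq_square)

text \<open>
  Since \<open>s \<theta> = - \<theta> s\<close>, both \<open>S D\<close> and \<open>D' S\<close> are combinations of \<open>\<theta>\<^sup>2\<close>, \<open>\<theta>\<close>, \<open>\<theta> s\<close>, \<open>1\<close> and \<open>s\<close> with
  coefficients on the left. That of \<open>\<theta>\<^sup>2\<close> is \<open>p\<close> on both sides; the hypotheses compare the other four.
\<close>

lemma intertwines_Cherednik:
  assumes "p * (reflection_coeff k - reflection_coeff k' + cst (rho k' - rho k)) = theta p"
    and "- p * reflection_coeff k - r = r + reflection_coeff k' * s_act p"
    and "p * theta (reflection_coeff k) + q * reflection_coeff k - q * cst (rho k)
        - r * s_act (reflection_coeff k)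
      = theta q + reflection_coeff k' * (q - s_act r) - cst (rho k') * q"
    and "- p * theta (reflection_coeff k) - q * reflection_coeff k + r * s_act (reflection_coeff k)
        - r * cst (rho k)
      = theta r + reflection_coeff k' * (r - s_act q) - cst (rho k') * r"
  defines "S \<equiv> \<lambda>f. p * theta f + q * f + r * s_act f"
  shows "S \<circ> Cherednik k = Cherednik k' \<circ> S"
proof
  fix f
  define f' where "f' = s_act f"
  have s: "s_act f = f'" "s_act f' = f" "s_act (theta f) = - theta f'" "s_act (theta f') = - theta f"
    by (simp_all add: f'_def s_act_s_act theta_s_act s_act_uminus)
  let ?A = "reflection_coeff k" and ?A' = "reflection_coeff k'"
  have "(S \<circ> Cherednik k) f - (Cherednik k' \<circ> S) f
    = (p * (?A - ?A' + cst (rho k' - rho k)) - theta p) * theta f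
    + ((- p * ?A - r) - (r + ?A' * s_act p)) * theta f'
    + ((p * theta ?A + q * ?A - q * cst (rho k) - r * s_act ?A)
        - (theta q + ?A' * (q - s_act r) - cst (rho k') * q)) * f
    + ((- p * theta ?A - q * ?A + r * s_act ?A - r * cst (rho k))
        - (theta r + ?A' * (r - s_act q) - cst (rho k') * r)) * f'"
    unfolding S_def comp_def Cherednik_eq s_act_hom theta_rules s cst_diff
    by (simp add: algebra_simps)
  also have "\<dots> = 0"
    using assms(1-4) by simp
  finally show "(S \<circ> Cherednik k) f = (Cherednik k' \<circ> S) f"
    by simp
qed

lemma intertwining_G_plus:
  fixes k :: "complex \<times> complex"
  defines "p \<equiv> Z / (Z ^ 2 - 1)" and "r \<equiv> Z ^ 3 / (Z ^ 2 - 1) ^ 2"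
  shows "(\<lambda>f. p * theta f + (- r) * f + r * s_act f) \<circ> Cherednik k
    = Cherednik (shift_by k (0, 1)) \<circ> (\<lambda>f. p * theta f + (- r) * f + r * s_act f)"
proof -
  have theta: "theta p = - Z * (Z ^ 2 + 1) / (Z ^ 2 - 1) ^ 2"
      "theta r = - (Z ^ 3) * (Z ^ 2 + 3) / (Z ^ 2 - 1) ^ 3"
    using Z_square_neq_1
    by (simp_all add: p_def r_def theta_divide theta_rules divide_simps) algebra+
  have s: "s_act p = - p" "s_act r = Z / (Z ^ 2 - 1) ^ 2"
    using Z_square_neq_1 Z_nonzero
    by (simp_all add: p_def r_def s_act_hom divide_simps) algebra+
  show ?thesis
    by (rule intertwines_Cherednik,
        unfold s_act_reflection_coeff theta_reflection_coeff theta s s_act_uminus theta_uminus,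
        unfold reflection_coeff_def rho_def shift_by_def p_def r_def,
        insert Z_nonzero Z_square_neq_1,
        simp_all add: cst_hom divide_simps,
        algebra+)
qed

lemma intertwining_G_minus:
  fixes k :: "complex \<times> complex"
  defines "p \<equiv> Z - inverse Z"
    and "q \<equiv> cst (fst k + 2 * snd k - 1) * (Z + inverse Z) + cst (2 * fst k) + inverse Z"
  shows "(\<lambda>f. p * theta f + q * f + (- Z) * s_act f) \<circ> Cherednik k
    = Cherednik (shift_by k (0, - 1)) \<circ> (\<lambda>f. p * theta f + q * f + (- Z) * s_act f)"
proof -
  have theta: "theta p = Z + inverse Z"
      "theta q = cst (fst k + 2 * snd k - 1) * (Z - inverse Z) - inverse Z"
    using Z_nonzero
    unfolding p_def q_def theta_rules theta_inverse
    by (simp_all add: field_simps power2_eq_square)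
  have s: "s_act p = - p" "s_act q = q + Z - inverse Z"
    by (simp_all add: p_def q_def s_act_hom algebra_simps)
  show ?thesis
    by (rule intertwines_Cherednik,
        unfold s_act_reflection_coeff theta_reflection_coeff theta s s_act_uminus theta_uminus
      theta_Z s_act_Z,
        unfold reflection_coeff_def rho_def shift_by_def p_def q_def,
        insert Z_nonzero Z_square_neq_1,
        simp_all add: cst_hom divide_simps,
        algebra+)
qed

lemma intertwining_E_plus:
  fixes k :: "complex \<times> complex"
  defines "p \<equiv> (Z + 1) / (Z - 1)" and "q \<equiv> cst (snd k - 1 / 2) - Z / (Z - 1) ^ 2"
    and "r \<equiv> Z / (Z - 1) ^ 2"
  shows "(\<lambda>f. p * theta f + q * f + r * s_act f) \<circ> Cherednik k
    = Cherednik (shift_by k (2, - 1)) \<circ> (\<lambda>f. p * theta f + q * f + r * s_act f)"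
proof -
  have theta: "theta p = - 2 * Z / (Z - 1) ^ 2" "theta r = - Z * (Z + 1) / (Z - 1) ^ 3"
    using Z_neq_1
    by (simp_all add: p_def r_def theta_divide theta_rules divide_simps) algebra+
  then have theta_q: "theta q = Z * (Z + 1) / (Z - 1) ^ 3"
    by (simp add: q_def theta_rules flip: r_def)
  have s: "s_act p = - p" "s_act r = r"
    using Z_neq_1 Z_nonzero
    by (simp_all add: p_def r_def s_act_hom divide_simps) algebra+
  then have s_q: "s_act q = q"
    by (simp add: q_def s_act_diff s_act_cst flip: r_def)
  show ?thesis
    by (rule intertwines_Cherednik,
        unfold s_act_reflection_coeff theta_reflection_coeff theta theta_q s s_q,
        unfold reflection_coeff_def rho_def shift_by_def p_def q_def r_def,
        unfold Z_square_minus_1_eq, insert Z_nonzero Z_neq_1 Z_neq_minus_1,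
        simp_all add: cst_hom divide_simps add_eq_0_iff2,
        algebra+)
qed

lemma intertwining_E_minus:
  fixes k :: "complex \<times> complex"
  defines "p \<equiv> (Z - 1) / (Z + 1)" and "q \<equiv> cst (fst k + snd k - 1 / 2) + Z / (Z + 1) ^ 2"
    and "r \<equiv> Z / (Z + 1) ^ 2"
  shows "(\<lambda>f. p * theta f + q * f + (- r) * s_act f) \<circ> Cherednik k
    = Cherednik (shift_by k (- 2, 1)) \<circ> (\<lambda>f. p * theta f + q * f + (- r) * s_act f)"
proof -
  \<comment> \<open>The forms in which \<open>z + 1\<close> appears as a denominator after multiplication by 2.\<close>
  have two: "2 * Z + 2 \<noteq> 0" "Z * 2 + 2 \<noteq> 0"
    using Z_plus_1_nonzero by (simp_all add: add_eq_0_iff2)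
  have theta: "theta p = 2 * Z / (Z + 1) ^ 2" "theta r = Z * (1 - Z) / (Z + 1) ^ 3"
    using Z_plus_1_nonzero
    by (simp_all add: p_def r_def theta_divide theta_rules divide_simps) algebra+
  then have theta_q: "theta q = Z * (1 - Z) / (Z + 1) ^ 3"
    by (simp add: q_def theta_rules flip: r_def)
  have s: "s_act p = - p" "s_act r = r"
    using Z_plus_1_nonzero Z_nonzero
    by (simp_all add: p_def r_def s_act_hom divide_simps) algebra+
  then have s_q: "s_act q = q"
    by (simp add: q_def s_act_add s_act_cst flip: r_def)
  show ?thesis
    by (rule intertwines_Cherednik,
        unfold s_act_reflection_coeff theta_reflection_coeff theta theta_q s s_q s_act_uminus theta_uminus,
        unfold reflection_coeff_def rho_def shift_by_def p_def q_def r_def,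
        unfold Z_square_minus_1_eq, insert Z_nonzero Z_neq_1 Z_plus_1_nonzero two,
        simp_all add: cst_hom divide_simps,
        algebra+)
qed

section \<open>The four shift operators\<close>

lemma scalar_operators_homogeneous:
  "G_plus k (cst t * f) = cst t * G_plus k f" "G_minus k (cst t * f) = cst t * G_minus k f"
  "E_plus k (cst t * f) = cst t * E_plus k f" "E_minus k (cst t * f) = cst t * E_minus k f"
  unfolding G_plus_def G_minus_def E_plus_def E_minus_def theta_scale
  by (simp_all add: algebra_simps)

text \<open>
  With \<open>f' = df/dx\<close> the hypothesis is the chain rule. The factor \<open>\<Delta>/2\<close> turns the coefficient of
  \<open>z\<partial>\<^sub>z\<close> in each operator into a polynomial in \<open>x\<close>: \<open>1/2\<close>, \<open>\<Delta>\<^sup>2/2 = 2 (x\<^sup>2 - 1)\<close>, \<open>x + 1\<close> and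
  \<open>x - 1\<close> respectively.
\<close>

lemma scalar_operators_symmetric:
  assumes "theta f = Delta / 2 * f'"
  shows "G_plus k f = f' / 2"
    and "G_minus k f = 2 * (X ^ 2 - 1) * f'
      + (cst (fst k + 2 * snd k - 1) * (2 * X) + cst (2 * fst k)) * f"
    and "E_plus k f = (X + 1) * f' + cst (snd k - 1 / 2) * f"
    and "E_minus k f = (X - 1) * f' + cst (fst k + snd k - 1 / 2) * f"
proof -
  show "G_plus k f = f' / 2"
    using Delta_nonzero by (simp add: G_plus_def assms flip: Delta_def)
  have "(Z - inverse Z) * (Delta / 2) = 2 * (X ^ 2 - 1)" "Z + inverse Z = 2 * X"
    unfolding Delta_def X_def using Z_nonzero by (simp_all add: field_simps power2_eq_square)
  then show "G_minus k f
      = 2 * (X ^ 2 - 1) * f' + (cst (fst k + 2 * snd k - 1) * (2 * X) + cst (2 * fst k)) * f"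
    unfolding G_minus_def assms by (simp only: flip: mult.assoc)
  have "(1 + inverse Z) / (1 - inverse Z) * (Delta / 2) = X + 1"
    unfolding Delta_def X_def using Z_nonzero Z_neq_1
    by (simp add: divide_simps) algebra
  then show "E_plus k f = (X + 1) * f' + cst (snd k - 1 / 2) * f"
    unfolding E_plus_def assms by (simp only: flip: mult.assoc)
  have "(1 - inverse Z) / (1 + inverse Z) * (Delta / 2) = X - 1"
    unfolding Delta_def X_def using Z_nonzero Z_plus_1_nonzero
    by (simp add: divide_simps) algebra
  then show "E_minus k f = (X - 1) * f' + cst (fst k + snd k - 1 / 2) * f"
    unfolding E_minus_def assms by (simp only: flip: mult.assoc)
qed

lemma theta_components:
  assumes "theta f1 = Delta / 2 * f1'" "theta f2 = Delta / 2 * f2'"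
  shows "theta (f1 + f2) = Delta / 2 * (f1' + f2')" "theta (f1 - f2) = Delta / 2 * (f1' - f2')"
    and "theta (f1 + f2 * Z) = Delta / 2 * (f1' + f2' * Z) + f2 * Z"
  using assms by (simp_all add: theta_rules algebra_simps)

lemma diff_s_act_components:
  assumes "f1 \<in> Poly_x" "f2 \<in> Poly_x"
  shows "f1 + f2 * Z - s_act (f1 + f2 * Z) = f2 * Delta"
  using assms by (simp add: s_act_hom s_act_Poly_x Delta_def algebra_simps)

text \<open>
  This isolates what has to be computed for each operator: its normal form, the intertwining relation,
  and its action on the components \<open>f\<^sub>1, f\<^sub>2\<close> in terms of their \<open>x\<close>-derivatives \<open>f\<^sub>1', f\<^sub>2'\<close>.
\<close>

lemma pullback_characterization_and_shift:
  assumes S0: "S0 = (\<lambda>f. p * theta f + q * f + r * s_act f)"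
    and coeffs: "p \<in> Laurent_Delta" "q \<in> Laurent_Delta" "r \<in> Laurent_Delta"
    and intertwining: "(\<lambda>f. p * theta f + q * f + r * s_act f) \<circ> Cherednik k
      = Cherednik (shift_by k l) \<circ> (\<lambda>f. p * theta f + q * f + r * s_act f)"
    and even: "even (fst l)"
    and comps: "\<And>f1 f2 f1' f2'. f1 \<in> Poly_x \<Longrightarrow> f2 \<in> Poly_x \<Longrightarrow> f1' \<in> Poly_x \<Longrightarrow> f2' \<in> Poly_x \<Longrightarrow>
      theta f1 = Delta / 2 * f1' \<Longrightarrow> theta f2 = Delta / 2 * f2' \<Longrightarrow>
      \<exists>h1\<in>Poly_x. \<exists>h2\<in>Poly_x. A (vector [f1, f2]) = vector [h1, h2] \<and> S0 (f1 + f2 * Z) = h1 + h2 * Z"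
  shows "(is_pullback A S \<longleftrightarrow> S = S0) \<and> (is_pullback A S \<longrightarrow> nonsym_shift_operator k l S)"
proof -
  have ops: "S0 \<in> diff_refl_ops"
    unfolding S0 using coeffs by (rule first_order_in_diff_refl_ops)
  have "(is_pullback A S \<longleftrightarrow> S = S0) \<and> (\<forall>f\<in>Laurent. S0 f \<in> Laurent)"
  proof (rule is_pullback_iff_and_Laurent[OF ops])
    fix f1 f2
    assume f: "f1 \<in> Poly_x" "f2 \<in> Poly_x"
    obtain f1' where f1': "f1' \<in> Poly_x" "theta f1 = Delta / 2 * f1'"
      using f(1) by (rule theta_Poly_x)
    obtain f2' where f2': "f2' \<in> Poly_x" "theta f2 = Delta / 2 * f2'"
      using f(2) by (rule theta_Poly_x)
    show "\<exists>h1\<in>Poly_x. \<exists>h2\<in>Poly_x. A (vector [f1, f2]) = vector [h1, h2]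
        \<and> S0 (f1 + f2 * Z) = h1 + h2 * Z"
      using f f1'(1) f2'(1) f1'(2) f2'(2) by (rule comps)
  qed
  then show ?thesis
    using ops intertwining even unfolding nonsym_shift_operator_def S0 by blast
qed

lemma Delta_in_Laurent: "Delta \<in> Laurent"
  unfolding Delta_def by (intro Laurent_intros)

text \<open>
  \<open>G\<^sub>+\<close> does not depend on \<open>k\<close>, so the matrix operator is scalar and conjugation by \<open>U\<close> leaves it
  unchanged. The reflection term removes \<open>f\<^sub>2 z / \<Delta>\<close>, which comes from \<open>z\<partial>\<^sub>z\<close> acting on the factor
  \<open>z\<close> of \<open>f\<^sub>2 z\<close>.
\<close>

lemma pullback_G_plus:
  "(is_pullback (conj_U (G_hat_plus k)) S \<longleftrightarrow>
      S = (\<lambda>f. G_plus k f - Z * (f - s_act f) / (Z - inverse Z) ^ 2)) \<and>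
   (is_pullback (conj_U (G_hat_plus k)) S \<longrightarrow> nonsym_shift_operator k (0, 1) S)"
proof (rule pullback_characterization_and_shift[OF _ _ _ _ intertwining_G_plus])
  have p: "Z / (Z ^ 2 - 1) = 1 / Delta ^ 1" and r: "Z ^ 3 / (Z ^ 2 - 1) ^ 2 = Z / Delta ^ 2"
    using Z_nonzero by (simp_all add: Delta_eq power_divide power3_eq_cube power2_eq_square)
  show "Z / (Z ^ 2 - 1) \<in> Laurent_Delta" "Z ^ 3 / (Z ^ 2 - 1) ^ 2 \<in> Laurent_Delta"
    "- (Z ^ 3 / (Z ^ 2 - 1) ^ 2) \<in> Laurent_Delta"
    unfolding p r minus_divide_left by (intro Laurent_Delta_of_Laurent Laurent_intros)+
  show "(\<lambda>f. G_plus k f - Z * (f - s_act f) / (Z - inverse Z) ^ 2)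
      = (\<lambda>f. Z / (Z ^ 2 - 1) * theta f + - (Z ^ 3 / (Z ^ 2 - 1) ^ 2) * f
          + Z ^ 3 / (Z ^ 2 - 1) ^ 2 * s_act f)"
    unfolding p r G_plus_def Delta_def[symmetric]
    by (simp add: fun_eq_iff right_diff_distrib diff_divide_distrib)
next
  fix f1 f2 f1' f2'
  assume f: "f1 \<in> Poly_x" "f2 \<in> Poly_x" "f1' \<in> Poly_x" "f2' \<in> Poly_x"
    and t: "theta f1 = Delta / 2 * f1'" "theta f2 = Delta / 2 * f2'"
  show "\<exists>h1\<in>Poly_x. \<exists>h2\<in>Poly_x. conj_U (G_hat_plus k) (vector [f1, f2]) = vector [h1, h2]
    \<and> G_plus k (f1 + f2 * Z) - Z * (f1 + f2 * Z - s_act (f1 + f2 * Z)) / (Z - inverse Z) ^ 2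
      = h1 + h2 * Z"
  proof (intro bexI conjI)
    show "conj_U (G_hat_plus k) (vector [f1, f2]) = vector [f1' / 2, f2' / 2]"
      unfolding G_hat_plus_def
      by (rule trans[OF conj_U_mat2], simp_all add: scalar_operators_homogeneous)
        (simp add: scalar_operators_symmetric[OF theta_components(1)[OF t]]
          scalar_operators_symmetric[OF theta_components(2)[OF t]] vec_eq_iff forall_2 field_simps)
    show "G_plus k (f1 + f2 * Z) - Z * (f1 + f2 * Z - s_act (f1 + f2 * Z)) / (Z - inverse Z) ^ 2
      = f1' / 2 + f2' / 2 * Z"
      unfolding diff_s_act_components[OF f(1,2)] G_plus_def theta_components(3)[OF t]
        Delta_def[symmetric]
      using Delta_nonzero by (simp add: field_simps power2_eq_square)
  qed (intro Poly_x_intros f)+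
qed simp

text \<open>
  The diagonal entries are \<open>L + 2\<close> and \<open>L - 2\<close>, where \<open>L = \<Delta> z\<partial>\<^sub>z + 2 (k\<^sub>1 + 2 k\<^sub>2) x + 2 k\<^sub>1\<close>.
  Conjugation by \<open>U\<close> turns them into \<open>L\<close> on the diagonal and \<open>- 2\<close> off the diagonal.
\<close>

lemma pullback_G_minus:
  "(is_pullback (conj_U (G_hat_minus k)) S \<longleftrightarrow>
      S = (\<lambda>f. G_minus k f + inverse Z * f - Z * s_act f)) \<and>
   (is_pullback (conj_U (G_hat_minus k)) S \<longrightarrow> nonsym_shift_operator k (0, - 1) S)"
proof (rule pullback_characterization_and_shift[OF _ _ _ _ intertwining_G_minus])
  show "Z - inverse Z \<in> Laurent_Delta" "- Z \<in> Laurent_Delta"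
    "cst (fst k + 2 * snd k - 1) * (Z + inverse Z) + cst (2 * fst k) + inverse Z \<in> Laurent_Delta"
    by (intro subsetD[OF Laurent_subset_Laurent_Delta] Laurent_intros)+
  show "(\<lambda>f. G_minus k f + inverse Z * f - Z * s_act f)
      = (\<lambda>f. (Z - inverse Z) * theta f
          + (cst (fst k + 2 * snd k - 1) * (Z + inverse Z) + cst (2 * fst k) + inverse Z) * f
          + - Z * s_act f)"
    unfolding G_minus_def by (simp add: fun_eq_iff algebra_simps)
next
  fix f1 f2 f1' f2'
  assume f: "f1 \<in> Poly_x" "f2 \<in> Poly_x" "f1' \<in> Poly_x" "f2' \<in> Poly_x"
    and t: "theta f1 = Delta / 2 * f1'" "theta f2 = Delta / 2 * f2'"
  define L where "L = (\<lambda>f f'. 2 * (X * X - 1) * f'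
    + (2 * cst (fst k + 2 * snd k) * X + cst (2 * fst k)) * f)"
  show "\<exists>h1\<in>Poly_x. \<exists>h2\<in>Poly_x. conj_U (G_hat_minus k) (vector [f1, f2]) = vector [h1, h2]
    \<and> G_minus k (f1 + f2 * Z) + inverse Z * (f1 + f2 * Z) - Z * s_act (f1 + f2 * Z) = h1 + h2 * Z"
  proof (intro bexI conjI)
    show "conj_U (G_hat_minus k) (vector [f1, f2])
        = vector [L f1 f1' - 2 * f2, L f2 f2' - 2 * f1]"
      unfolding G_hat_minus_def
      by (rule trans[OF conj_U_mat2], simp_all add: scalar_operators_homogeneous)
        (simp add: scalar_operators_symmetric[OF theta_components(1)[OF t]]
          scalar_operators_symmetric[OF theta_components(2)[OF t]] vec_eq_iff forall_2
          L_def k_plus_def k_minus_def cst_hom field_simps power2_eq_square)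
    show "G_minus k (f1 + f2 * Z) + inverse Z * (f1 + f2 * Z) - Z * s_act (f1 + f2 * Z)
      = (L f1 f1' - 2 * f2) + (L f2 f2' - 2 * f1) * Z"
      unfolding G_minus_def theta_components(3)[OF t] s_act_add s_act_mult s_act_Z
        s_act_Poly_x[OF f(1)] s_act_Poly_x[OF f(2)] L_def X_def Delta_def
      using Z_nonzero by (simp add: cst_hom divide_simps) algebra
    show "L f1 f1' - 2 * f2 \<in> Poly_x" "L f2 f2' - 2 * f1 \<in> Poly_x"
      unfolding L_def by (intro Poly_x_intros f)+
  qed
qed simp

text \<open>
  Here the lower diagonal entry exceeds the upper one, \<open>E\<^sub>+(k\<^sub>+) = E\<^sub>+(k)\<close>, by \<open>1\<close>. Together with the
  entry \<open>- 1\<close> below the diagonal, conjugation by \<open>U\<close> yields the upper triangular matrix with diagonal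
  \<open>E\<^sub>+(k)\<close>, \<open>E\<^sub>+(k) + 1\<close> and with \<open>1\<close> above it.
\<close>

lemma pullback_E_plus:
  "(is_pullback (conj_U (E_hat_plus k)) S \<longleftrightarrow>
      S = (\<lambda>f. E_plus k f
        - (1 + inverse Z) / (1 - inverse Z) * ((f - s_act f) / (Z - inverse Z)))) \<and>
   (is_pullback (conj_U (E_hat_plus k)) S \<longrightarrow> nonsym_shift_operator k (2, - 1) S)"
proof (rule pullback_characterization_and_shift[OF _ _ _ _ intertwining_E_plus])
  have p: "(Z + 1) / (Z - 1) = inverse Z * (Z + 1) ^ 2 / Delta ^ 1"
    and r: "Z / (Z - 1) ^ 2 = inverse Z * (Z + 1) ^ 2 / Delta ^ 2"
    unfolding Delta_eq Z_square_minus_1_eq using Z_nonzero Z_neq_1 Z_plus_1_nonzero by (simp_all add: divide_simps) algebra+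
  have q: "cst (snd k - 1 / 2) - Z / (Z - 1) ^ 2
      = (cst (snd k - 1 / 2) * Delta ^ 2 - inverse Z * (Z + 1) ^ 2) / Delta ^ 2"
    unfolding r using Delta_nonzero by (simp add: field_simps)
  show "(Z + 1) / (Z - 1) \<in> Laurent_Delta" "Z / (Z - 1) ^ 2 \<in> Laurent_Delta"
    "cst (snd k - 1 / 2) - Z / (Z - 1) ^ 2 \<in> Laurent_Delta"
    unfolding p r[symmetric] q unfolding r
    by (intro Laurent_Delta_of_Laurent Laurent_intros Delta_in_Laurent)+
  show "(\<lambda>f. E_plus k f - (1 + inverse Z) / (1 - inverse Z) * ((f - s_act f) / (Z - inverse Z)))
      = (\<lambda>f. (Z + 1) / (Z - 1) * theta f + (cst (snd k - 1 / 2) - Z / (Z - 1) ^ 2) * f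
          + Z / (Z - 1) ^ 2 * s_act f)"
  proof
    fix f
    have c: "(1 + inverse Z) / (1 - inverse Z) = (Z + 1) / (Z - 1)"
      using Z_nonzero Z_neq_1 by (simp add: divide_simps)
    have e: "(Z + 1) / (Z - 1) / (Z - inverse Z) = Z / (Z - 1) ^ 2"
      unfolding Delta_def[symmetric] Delta_eq Z_square_minus_1_eq using Z_nonzero Z_neq_1 Z_plus_1_nonzero
      by (simp add: divide_simps power2_eq_square)
    have d: "(Z + 1) / (Z - 1) * (g / (Z - inverse Z)) = Z / (Z - 1) ^ 2 * g" for g
      unfolding e[symmetric] by simp
    show "E_plus k f - (1 + inverse Z) / (1 - inverse Z) * ((f - s_act f) / (Z - inverse Z))
      = (Z + 1) / (Z - 1) * theta f + (cst (snd k - 1 / 2) - Z / (Z - 1) ^ 2) * f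
          + Z / (Z - 1) ^ 2 * s_act f"
      unfolding E_plus_def c d by (simp add: algebra_simps diff_divide_distrib)
  qed
next
  fix f1 f2 f1' f2'
  assume f: "f1 \<in> Poly_x" "f2 \<in> Poly_x" "f1' \<in> Poly_x" "f2' \<in> Poly_x"
    and t: "theta f1 = Delta / 2 * f1'" "theta f2 = Delta / 2 * f2'"
  show "\<exists>h1\<in>Poly_x. \<exists>h2\<in>Poly_x. conj_U (E_hat_plus k) (vector [f1, f2]) = vector [h1, h2]
    \<and> E_plus k (f1 + f2 * Z) - (1 + inverse Z) / (1 - inverse Z)
        * ((f1 + f2 * Z - s_act (f1 + f2 * Z)) / (Z - inverse Z)) = h1 + h2 * Z"
  proof (intro bexI conjI)
    show "conj_U (E_hat_plus k) (vector [f1, f2])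
        = vector [(X + 1) * f1' + cst (snd k - 1 / 2) * f1 + f2,
            (X + 1) * f2' + cst (snd k + 1 / 2) * f2]"
      unfolding E_hat_plus_def
      by (rule trans[OF conj_U_mat2], simp_all add: scalar_operators_homogeneous)
        (simp add: scalar_operators_symmetric[OF theta_components(1)[OF t]]
          scalar_operators_symmetric[OF theta_components(2)[OF t]] vec_eq_iff forall_2
          k_plus_def k_minus_def cst_hom field_simps)
    have cancel: "f2 * Delta / (Z - inverse Z) = f2"
      using Delta_nonzero by (simp flip: Delta_def)
    show "E_plus k (f1 + f2 * Z) - (1 + inverse Z) / (1 - inverse Z)
        * ((f1 + f2 * Z - s_act (f1 + f2 * Z)) / (Z - inverse Z))
      = ((X + 1) * f1' + cst (snd k - 1 / 2) * f1 + f2)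
        + ((X + 1) * f2' + cst (snd k + 1 / 2) * f2) * Z"
      unfolding diff_s_act_components[OF f(1,2)] cancel
      unfolding E_plus_def theta_components(3)[OF t] X_def Delta_def
      using Z_nonzero Z_neq_1 by (simp add: cst_hom divide_simps) algebra
    show "(X + 1) * f1' + cst (snd k - 1 / 2) * f1 + f2 \<in> Poly_x"
      "(X + 1) * f2' + cst (snd k + 1 / 2) * f2 \<in> Poly_x"
      by (intro Poly_x_intros f)+
  qed
qed simp


text \<open>
  Now \<open>E\<^sub>-(k\<^sub>-) = E\<^sub>-(k)\<close> and \<open>E\<^sub>-(k\<^sub>+) = E\<^sub>-(k) + 1\<close>. The entry \<open>- 1\<close> above the diagonal makes
  the conjugate upper triangular again, with diagonal \<open>E\<^sub>-(k)\<close>, \<open>E\<^sub>-(k) + 1\<close> and with \<open>- 1\<close> above it.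
\<close>

lemma pullback_E_minus:
  "(is_pullback (conj_U (E_hat_minus k)) S \<longleftrightarrow>
      S = (\<lambda>f. E_minus k f
        + (1 - inverse Z) / (1 + inverse Z) * ((f - s_act f) / (Z - inverse Z)))) \<and>
   (is_pullback (conj_U (E_hat_minus k)) S \<longrightarrow> nonsym_shift_operator k (- 2, 1) S)"
proof (rule pullback_characterization_and_shift[OF _ _ _ _ intertwining_E_minus])
  have p: "(Z - 1) / (Z + 1) = inverse Z * (Z - 1) ^ 2 / Delta ^ 1"
    and r: "Z / (Z + 1) ^ 2 = inverse Z * (Z - 1) ^ 2 / Delta ^ 2"
    unfolding Delta_eq Z_square_minus_1_eq using Z_nonzero Z_plus_1_nonzero Z_neq_1 by (simp_all add: divide_simps) algebra+
  have q: "cst (fst k + snd k - 1 / 2) + Z / (Z + 1) ^ 2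
      = (cst (fst k + snd k - 1 / 2) * Delta ^ 2 + inverse Z * (Z - 1) ^ 2) / Delta ^ 2"
    unfolding r using Delta_nonzero by (simp add: field_simps)
  show "(Z - 1) / (Z + 1) \<in> Laurent_Delta" "- (Z / (Z + 1) ^ 2) \<in> Laurent_Delta"
    "cst (fst k + snd k - 1 / 2) + Z / (Z + 1) ^ 2 \<in> Laurent_Delta"
    unfolding p r[symmetric] q unfolding r minus_divide_left
    by (intro Laurent_Delta_of_Laurent Laurent_intros Delta_in_Laurent)+
  show "(\<lambda>f. E_minus k f + (1 - inverse Z) / (1 + inverse Z) * ((f - s_act f) / (Z - inverse Z)))
      = (\<lambda>f. (Z - 1) / (Z + 1) * theta f + (cst (fst k + snd k - 1 / 2) + Z / (Z + 1) ^ 2) * f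
          + - (Z / (Z + 1) ^ 2) * s_act f)"
  proof
    fix f
    have c: "(1 - inverse Z) / (1 + inverse Z) = (Z - 1) / (Z + 1)"
      using Z_nonzero Z_plus_1_nonzero by (simp add: divide_simps)
    have e: "(Z - 1) / (Z + 1) / (Z - inverse Z) = Z / (Z + 1) ^ 2"
      unfolding Delta_def[symmetric] Delta_eq Z_square_minus_1_eq using Z_nonzero Z_plus_1_nonzero Z_neq_1
      by (simp add: divide_simps power2_eq_square)
    have d: "(Z - 1) / (Z + 1) * (g / (Z - inverse Z)) = Z / (Z + 1) ^ 2 * g" for g
      unfolding e[symmetric] by simp
    show "E_minus k f + (1 - inverse Z) / (1 + inverse Z) * ((f - s_act f) / (Z - inverse Z))
      = (Z - 1) / (Z + 1) * theta f + (cst (fst k + snd k - 1 / 2) + Z / (Z + 1) ^ 2) * f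
          + - (Z / (Z + 1) ^ 2) * s_act f"
      unfolding E_minus_def c d by (simp add: algebra_simps diff_divide_distrib)
  qed
next
  fix f1 f2 f1' f2'
  assume f: "f1 \<in> Poly_x" "f2 \<in> Poly_x" "f1' \<in> Poly_x" "f2' \<in> Poly_x"
    and t: "theta f1 = Delta / 2 * f1'" "theta f2 = Delta / 2 * f2'"
  show "\<exists>h1\<in>Poly_x. \<exists>h2\<in>Poly_x. conj_U (E_hat_minus k) (vector [f1, f2]) = vector [h1, h2]
    \<and> E_minus k (f1 + f2 * Z) + (1 - inverse Z) / (1 + inverse Z)
        * ((f1 + f2 * Z - s_act (f1 + f2 * Z)) / (Z - inverse Z)) = h1 + h2 * Z"
  proof (intro bexI conjI)
    show "conj_U (E_hat_minus k) (vector [f1, f2])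
        = vector [(X - 1) * f1' + cst (fst k + snd k - 1 / 2) * f1 - f2,
            (X - 1) * f2' + cst (fst k + snd k + 1 / 2) * f2]"
      unfolding E_hat_minus_def
      by (rule trans[OF conj_U_mat2], simp_all add: scalar_operators_homogeneous)
        (simp add: scalar_operators_symmetric[OF theta_components(1)[OF t]]
          scalar_operators_symmetric[OF theta_components(2)[OF t]] vec_eq_iff forall_2
          k_plus_def k_minus_def cst_hom field_simps)
    have cancel: "f2 * Delta / (Z - inverse Z) = f2"
      using Delta_nonzero by (simp flip: Delta_def)
    show "E_minus k (f1 + f2 * Z) + (1 - inverse Z) / (1 + inverse Z)
        * ((f1 + f2 * Z - s_act (f1 + f2 * Z)) / (Z - inverse Z))
      = ((X - 1) * f1' + cst (fst k + snd k - 1 / 2) * f1 - f2)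
        + ((X - 1) * f2' + cst (fst k + snd k + 1 / 2) * f2) * Z"
      unfolding diff_s_act_components[OF f(1,2)] cancel
      unfolding E_minus_def theta_components(3)[OF t] X_def Delta_def
      using Z_nonzero Z_plus_1_nonzero by (simp add: cst_hom divide_simps) algebra
    show "(X - 1) * f1' + cst (fst k + snd k - 1 / 2) * f1 - f2 \<in> Poly_x"
      "(X - 1) * f2' + cst (fst k + snd k + 1 / 2) * f2 \<in> Poly_x"
      by (intro Poly_x_intros f)+
  qed
qed simp


theorem proposition4p3:
  fixes k :: "complex \<times> complex"
    and cG_plus cG_minus cE_plus cE_minus :: "ratfun \<Rightarrow> ratfun"
  shows
    "(is_pullback (conj_U (G_hat_plus k)) cG_plus \<longleftrightarrow>
        cG_plus = (\<lambda>f. G_plus k f - Z * (f - s_act f) / (Z - inverse Z) ^ 2)) \<and>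
     (is_pullback (conj_U (G_hat_minus k)) cG_minus \<longleftrightarrow>
        cG_minus = (\<lambda>f. G_minus k f + inverse Z * f - Z * s_act f)) \<and>
     (is_pullback (conj_U (E_hat_plus k)) cE_plus \<longleftrightarrow>
        cE_plus = (\<lambda>f. E_plus k f
          - (1 + inverse Z) / (1 - inverse Z) * ((f - s_act f) / (Z - inverse Z)))) \<and>
     (is_pullback (conj_U (E_hat_minus k)) cE_minus \<longleftrightarrow>
        cE_minus = (\<lambda>f. E_minus k f
          + (1 - inverse Z) / (1 + inverse Z) * ((f - s_act f) / (Z - inverse Z)))) \<and>
     (is_pullback (conj_U (G_hat_plus k)) cG_plus \<longrightarrow> nonsym_shift_operator k (0, 1) cG_plus) \<and>
     (is_pullback (conj_U (G_hat_minus k)) cG_minus \<longrightarrow> nonsym_shift_operator k (0, -1) cG_minus) \<and>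
     (is_pullback (conj_U (E_hat_plus k)) cE_plus \<longrightarrow> nonsym_shift_operator k (2, -1) cE_plus) \<and>
     (is_pullback (conj_U (E_hat_minus k)) cE_minus \<longrightarrow> nonsym_shift_operator k (-2, 1) cE_minus)"
  using pullback_G_plus[of k cG_plus] pullback_G_minus[of k cG_minus]
    pullback_E_plus[of k cE_plus] pullback_E_minus[of k cE_minus]
  by blast

end
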